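(* Let $\alpha,\beta\in\mathbb{R}$ and $\delta,\varepsilon>0$ be lattice parameters with $\alpha\neq\beta$ and $(\alpha-\beta)\delta+\varepsilon^2-\delta^2\neq0$, generic except that $\varepsilon=\delta$ is allowed, and let $\mathcal{E}=\{e^{(1)},\dots,e^{(12)}\}$ be the set of transformation strains of monoclinic-I martensite with these parameters. Let $\tau$ be one of the eight $T_3$s formed by strains in $\mathcal{E}$, let $\tau_1,\tau_2,\tau_3$ be the three neighbours of $\tau$ (in any order), and let $r$ be one of the two rotations associated with $\tau$. Let $n_{1,i}$ and $n'_{1,i}$, $i=1,2,3$, be the nodes of $\tau_1$ and of its dual $r_0\tau_1$, respectively. Pick $\mu_i,\mu_i'\in[0,1]$ such that $\sum_{i=1}^3\mu_i+\sum_{i=1}^3\mu'_i=1$ and let $$p_1=\sum_{i=1}^3\mu_i n_{1,i}+\sum_{i=1}^3\mu'_i n'_{1,i}.$$ (Thus $p_1$ is an element of the four-dimensional set $\mathcal{C}(\{n_{1,1},n_{1,2},n_{1,3},n'_{1,1},n'_{1,2},n'_{1,3}\})$, the convex hull of the six nodes, and can be attained by a lamination of these nodes, i.e. belongs to their symmetrised lamination convex hull.) Then $p_1,\ rp_1,\ r^2p_1$ form a symmetric $T_3$. The union of the $T_3$s $\mathcal{R}(\{p_1,rp_1,r^2p_1\})$, as $p_1$ varies, is a five-dimensional set. When $\varepsilon\leq\delta$ this set intersects the boundary of the symmetrised rank-one convex hull $\mathcal{R}(\mathcal{E})$.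
   Context: Strains. Write $M(a,b,c;p,q,s)$ for the real symmetric $3\times 3$ matrix with diagonal entries $a,b,c$, $(1,2)$-entry $p$, $(1,3)$-entry $q$ and $(2,3)$-entry $s$. The twelve transformation strains of monoclinic-I martensite with lattice parameters $\alpha,\beta,\delta,\varepsilon$ are $e^{(1)}=M(\alpha,\alpha,\beta;\delta,\varepsilon,\varepsilon)$, $e^{(2)}=M(\alpha,\alpha,\beta;\delta,-\varepsilon,-\varepsilon)$, $e^{(3)}=M(\alpha,\alpha,\beta;-\delta,-\varepsilon,\varepsilon)$, $e^{(4)}=M(\alpha,\alpha,\beta;-\delta,\varepsilon,-\varepsilon)$, $e^{(5)}=M(\alpha,\beta,\alpha;\varepsilon,\delta,\varepsilon)$, $e^{(6)}=M(\alpha,\beta,\alpha;-\varepsilon,\delta,-\varepsilon)$, $e^{(7)}=M(\alpha,\beta,\alpha;-\varepsilon,-\delta,\varepsilon)$, $e^{(8)}=M(\alpha,\beta,\alpha;\varepsilon,-\delta,-\varepsilon)$, $e^{(9)}=M(\beta,\alpha,\alpha;\varepsilon,\varepsilon,\delta)$, $e^{(10)}=M(\beta,\alpha,\alpha;-\varepsilon,-\varepsilon,\delta)$, $e^{(11)}=M(\beta,\alpha,\alpha;-\varepsilon,\varepsilon,-\delta)$, $e^{(12)}=M(\beta,\alpha,\alpha;\varepsilon,-\varepsilon,-\delta)$. All have trace $2\alpha+\beta$. Compatibility and hulls. Symmetric $3\times3$ matrices $e,f$ are compatible if $e-f=\frac12(a\otimes b+b\otimes a)$ for some $a,b\in\mathbb{R}^3$,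 and incompatible otherwise. A function $f$ from symmetric $3\times3$ real matrices to $\mathbb{R}$ is symmetrised rank-one convex if $f(\lambda x+(1-\lambda)y)\le\lambda f(x)+(1-\lambda)f(y)$ for all $\lambda\in[0,1]$ and all compatible $x,y$. For compact $E$, $\mathcal{R}(E)$ is the set of symmetric $e$ with $f(e)\le\sup_{E}f$ for all symmetrised rank-one convex $f$. The symmetrised lamination convex hull of $E$ is the smallest set $\widetilde E\supseteq E$ such that $[x,y]\subset\widetilde E$ whenever $x,y\in\widetilde E$ are compatible. $T_3$s. Let $(e,f)=\{\lambda e+(1-\lambda)f:\lambda\in(0,1)\}$ and let $[e,f]$ be the closed segment. Three symmetric $3\times3$ matrices $e_1,e_2,e_3$ of equal trace form a $T_3$ if they are pairwise incompatible and there exist $e_{1,1}\in(e_2,e_3)$, $e_{2,2}\in(e_3,e_1)$, $e_{3,3}\in(e_1,e_2)$ with $e_{i,i}$ compatible with $e_i$, $i=1,2,3$ (these $e_{i,i}$ are then unique). Write $e_{3,3}=\lambda_{12}e_1+(1-\lambda_{12})e_2$, $e_{1,1}=\lambda_{23}e_2+(1-\lambda_{23})e_3$, $e_{2,2}=\lambda_{31}e_3+(1-\lambda_{31})e_1$; the $T_3$ is symmetric if $\lambda_{12}=\lambda_{23}=\lambda_{31}$. The nodes of the $T_3$ are the three points $[e_i,e_{i,i}]\cap[e_j,e_{j,j}]$, $i\neq j$. The set $\mathcal{R}(\{e_1,e_2,e_3\})$ is also called a $T_3$, and $e_1,e_2,e_3$ its vertices. The eight $T_3$s. The triples of pairwise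 incompatible strains in $\mathcal{E}$ are those with index sets $\{1,6,12\},\{1,8,10\},\{2,5,11\},\{2,7,9\},\{3,6,9\},\{3,8,11\},\{4,5,10\},\{4,7,12\}$; each forms a $T_3$. The permutation $r_0$ of indices interchanges $1\leftrightarrow2$, $3\leftrightarrow4$, $5\leftrightarrow6$, $7\leftrightarrow8$, $9\leftrightarrow10$, $11\leftrightarrow12$; the dual $r_0\tau$ of one of these eight $T_3$s $\tau$ is the $T_3$ whose index set is the image of that of $\tau$ under $r_0$. These eight $T_3$s correspond to the corners of a cube whose edges correspond to the strains; the neighbours of $\tau$ (corners joined to $\tau$ by an edge of the cube) are the three $T_3$s among the eight, other than $\tau$, having a vertex in common with $\tau$. The rotation group of the cube acts on symmetric matrices by $e\mapsto ReR^T$, where $R$ ranges over the group generated by the rotations by $\pi/2$ about the coordinate axes; it maps $\mathcal{E}$ to itself. The rotations associated with $\tau$ are the two elements $r$ of order three of this group (rotations by $\pm2\pi/3$ about the cube's main diagonal through $\tau$ and $r_0\tau$) that map the vertex set of $\tau$ to itself; $r^2$ denotes $r$ applied twice. A subset of the five-dimensional affine space of symmetric matrices of trace $2\alpha+\beta$ is five-dimensional if it has nonempty interior in that space; the boundary of $\mathcal{R}(\mathcal{E})$ is taken relative to that space.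
   Formalization: "p₁, rp₁, r²p₁ form a symmetric T₃" is proved whenever p₁ and rp₁ are incompatible, which holds for generic p₁ in the hull (it fails when all weights are 1/6); the union is taken over those p₁ for which the triple is a T₃. *)

theory Defs
  imports "HOL-Analysis.Analysis"
begin

section \<open>Symmetric matrices and compatibility\<close>

abbreviation symmetric :: "real^3^3 \<Rightarrow> bool" where
  "symmetric e \<equiv> transpose e = e"

definition tensor :: "real^3 \<Rightarrow> real^3 \<Rightarrow> real^3^3" where
  "tensor a b = (\<chi> i j. a $ i * b $ j)"

definition compatible :: "real^3^3 \<Rightarrow> real^3^3 \<Rightarrow> bool" where
  "compatible e f \<longleftrightarrow> (\<exists>a b. e - f = (1/2) *\<^sub>R (tensor a b + tensor b a))"

text \<open>Functions on symmetric matrices are represented by functions on all matrices, of which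
  only the values at symmetric matrices are used.\<close>

definition sym_rank_one_convex :: "(real^3^3 \<Rightarrow> real) \<Rightarrow> bool" where
  "sym_rank_one_convex f \<longleftrightarrow>
     (\<forall>x y l. symmetric x \<and> symmetric y \<and> compatible x y \<and> 0 \<le> l \<and> l \<le> 1 \<longrightarrow>
        f (l *\<^sub>R x + (1 - l) *\<^sub>R y) \<le> l * f x + (1 - l) * f y)"

text \<open>The real-valued supremum is meaningful for nonempty compact sets of symmetric matrices, on
  which these functions are bounded; below the hull is only taken of finite nonempty sets.\<close>

definition rank_one_hull :: "(real^3^3) set \<Rightarrow> (real^3^3) set" where
  "rank_one_hull E =
     {e. symmetric e \<and> (\<forall>f. sym_rank_one_convex f \<longrightarrow> f e \<le> (SUP x\<in>E. f x))}"

definition lamination_convex :: "(real^3^3) set \<Rightarrow> bool" where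
  "lamination_convex S \<longleftrightarrow>
     (\<forall>x\<in>S. \<forall>y\<in>S. compatible x y \<longrightarrow> closed_segment x y \<subseteq> S)"

definition lamination_hull :: "(real^3^3) set \<Rightarrow> (real^3^3) set" where
  "lamination_hull E = lamination_convex hull E"

definition trace_space :: "real \<Rightarrow> (real^3^3) set" where
  "trace_space t = {e. symmetric e \<and> trace e = t}"

definition five_dimensional :: "real \<Rightarrow> (real^3^3) set \<Rightarrow> bool" where
  "five_dimensional t U \<longleftrightarrow>
     U \<subseteq> trace_space t \<and> (top_of_set (trace_space t)) interior_of U \<noteq> {}"


section \<open>\<open>T\<^sub>3\<close>s\<close>

text \<open>Triples are indexed cyclically by the three-element type, in which \<open>3 + 1 = 1\<close> and
  \<open>3 + 2 = 2\<close>. The point \<open>T3_inner_pt e l i\<close> is $e_{i,i}$, where \<open>l i\<close> is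
  $\lambda_{i+1,i+2}$: \<open>l 3\<close> is $\lambda_{12}$, \<open>l 1\<close> is $\lambda_{23}$ and \<open>l 2\<close> is
  $\lambda_{31}$.\<close>

definition T3_inner_pt :: "(3 \<Rightarrow> real^3^3) \<Rightarrow> (3 \<Rightarrow> real) \<Rightarrow> 3 \<Rightarrow> real^3^3" where
  "T3_inner_pt e l i = l i *\<^sub>R e (i + 1) + (1 - l i) *\<^sub>R e (i + 2)"

definition T3_with :: "(3 \<Rightarrow> real^3^3) \<Rightarrow> (3 \<Rightarrow> real) \<Rightarrow> bool" where
  "T3_with e l \<longleftrightarrow>
     (\<forall>i. symmetric (e i)) \<and>
     (\<forall>i j. trace (e i) = trace (e j)) \<and>
     (\<forall>i j. i \<noteq> j \<longrightarrow> \<not> compatible (e i) (e j)) \<and>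
     (\<forall>i. 0 < l i \<and> l i < 1 \<and> compatible (T3_inner_pt e l i) (e i))"

definition is_T3 :: "(3 \<Rightarrow> real^3^3) \<Rightarrow> bool" where
  "is_T3 e \<longleftrightarrow> (\<exists>l. T3_with e l)"

definition is_symmetric_T3 :: "(3 \<Rightarrow> real^3^3) \<Rightarrow> bool" where
  "is_symmetric_T3 e \<longleftrightarrow> (\<exists>l. T3_with e l \<and> l 3 = l 1 \<and> l 1 = l 2)"

definition T3_inner :: "(3 \<Rightarrow> real^3^3) \<Rightarrow> 3 \<Rightarrow> real^3^3" where
  "T3_inner e = T3_inner_pt e (THE l. T3_with e l)"

definition T3_node :: "(3 \<Rightarrow> real^3^3) \<Rightarrow> 3 \<Rightarrow> real^3^3" where
  "T3_node e i = the_elem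
     (closed_segment (e (i + 1)) (T3_inner e (i + 1)) \<inter>
      closed_segment (e (i + 2)) (T3_inner e (i + 2)))"


section \<open>The strains of monoclinic-I martensite\<close>

definition symmat :: "real \<Rightarrow> real \<Rightarrow> real \<Rightarrow> real \<Rightarrow> real \<Rightarrow> real \<Rightarrow> real^3^3" where
  "symmat a b c p q s = vector [vector [a, p, q], vector [p, b, s], vector [q, s, c]]"

text \<open>The strains are numbered from 1 to 12.\<close>

definition strain :: "real \<Rightarrow> real \<Rightarrow> real \<Rightarrow> real \<Rightarrow> nat \<Rightarrow> real^3^3" where
  "strain \<alpha> \<beta> \<delta> \<epsilon> k =
     [symmat \<alpha> \<alpha> \<beta>   \<delta>    \<epsilon>    \<epsilon>,
      symmat \<alpha> \<alpha> \<beta>   \<delta>  (-\<epsilon>) (-\<epsilon>),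
      symmat \<alpha> \<alpha> \<beta> (-\<delta>) (-\<epsilon>)   \<epsilon>,
      symmat \<alpha> \<alpha> \<beta> (-\<delta>)   \<epsilon>  (-\<epsilon>),
      symmat \<alpha> \<beta> \<alpha>   \<epsilon>    \<delta>    \<epsilon>,
      symmat \<alpha> \<beta> \<alpha> (-\<epsilon>)   \<delta>  (-\<epsilon>),
      symmat \<alpha> \<beta> \<alpha> (-\<epsilon>) (-\<delta>)   \<epsilon>,
      symmat \<alpha> \<beta> \<alpha>   \<epsilon>  (-\<delta>) (-\<epsilon>),
      symmat \<beta> \<alpha> \<alpha>   \<epsilon>    \<epsilon>    \<delta>,
      symmat \<beta> \<alpha> \<alpha> (-\<epsilon>) (-\<epsilon>)   \<delta>,
      symmat \<beta> \<alpha> \<alpha> (-\<epsilon>)   \<epsilon>  (-\<delta>),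
      symmat \<beta> \<alpha> \<alpha>   \<epsilon>  (-\<epsilon>) (-\<delta>)] ! (k - 1)"

definition strains :: "real \<Rightarrow> real \<Rightarrow> real \<Rightarrow> real \<Rightarrow> (real^3^3) set" where
  "strains \<alpha> \<beta> \<delta> \<epsilon> = strain \<alpha> \<beta> \<delta> \<epsilon> ` {1..12}"

definition T3_index_sets :: "nat set set" where
  "T3_index_sets =
     {{1,6,12}, {1,8,10}, {2,5,11}, {2,7,9}, {3,6,9}, {3,8,11}, {4,5,10}, {4,7,12}}"

text \<open>On \<open>{1..12}\<close> this interchanges 1 and 2, 3 and 4, and so on.\<close>

definition r0 :: "nat \<Rightarrow> nat" where
  "r0 k = (if odd k then k + 1 else k - 1)"

definition neighbours :: "nat set \<Rightarrow> nat set set" where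
  "neighbours \<tau> = {\<tau>' \<in> T3_index_sets. \<tau>' \<noteq> \<tau> \<and> \<tau>' \<inter> \<tau> \<noteq> {}}"


section \<open>Rotations of the cube\<close>

definition quarter_turns :: "(real^3^3) set" where
  "quarter_turns =
     {vector [vector [1, 0, 0], vector [0, 0, -1], vector [0, 1, 0]],
      vector [vector [0, 0, 1], vector [0, 1, 0], vector [-1, 0, 0]],
      vector [vector [0, -1, 0], vector [1, 0, 0], vector [0, 0, 1]]}"

text \<open>The generated group; no rule for inverses is needed as the generators have order four.\<close>

inductive_set cube_rotations :: "(real^3^3) set" where
  one: "mat 1 \<in> cube_rotations"
| step: "R \<in> cube_rotations \<Longrightarrow> Q \<in> quarter_turns \<Longrightarrow> R ** Q \<in> cube_rotations"

definition conj_act :: "real^3^3 \<Rightarrow> real^3^3 \<Rightarrow> real^3^3" where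
  "conj_act R e = R ** e ** transpose R"

definition associated_rotations :: "(real^3^3) set \<Rightarrow> (real^3^3) set" where
  "associated_rotations V =
     {R \<in> cube_rotations. R \<noteq> mat 1 \<and> R ** R ** R = mat 1 \<and> conj_act R ` V = V}"

definition orbit3 :: "real^3^3 \<Rightarrow> real^3^3 \<Rightarrow> 3 \<Rightarrow> real^3^3" where
  "orbit3 R p i = (if i = 1 then p else if i = 2 then conj_act R p else conj_act R (conj_act R p))"


section \<open>Mixtures of nodes and genericity\<close>

definition weights :: "((3 \<Rightarrow> real) \<times> (3 \<Rightarrow> real)) set" where
  "weights = {(\<mu>, \<mu>'). (\<forall>i. \<mu> i \<in> {0..1} \<and> \<mu>' i \<in> {0..1}) \<and> (\<Sum>i\<in>UNIV. \<mu> i) + (\<Sum>i\<in>UNIV. \<mu>' i) = 1}"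

definition mixture ::
  "(3 \<Rightarrow> real^3^3) \<Rightarrow> (3 \<Rightarrow> real^3^3) \<Rightarrow> (3 \<Rightarrow> real) \<times> (3 \<Rightarrow> real) \<Rightarrow> real^3^3" where
  "mixture n n' = (\<lambda>(\<mu>, \<mu>'). (\<Sum>i\<in>UNIV. \<mu> i *\<^sub>R n i) + (\<Sum>i\<in>UNIV. \<mu>' i *\<^sub>R n' i))"

text \<open>\<open>Q\<close> holds on \<open>S\<close> off the zero set of a polynomial that does not vanish identically on \<open>S\<close>.\<close>

definition generically_on :: "'a::real_normed_vector set \<Rightarrow> ('a \<Rightarrow> bool) \<Rightarrow> bool" where
  "generically_on S Q \<longleftrightarrow>
     (\<exists>P. real_polynomial_function P \<and> (\<exists>x\<in>S. P x \<noteq> 0) \<and> (\<forall>x\<in>S. P x \<noteq> 0 \<longrightarrow> Q x))"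

text \<open>Mixtures \<open>p\<close> that are compatible with \<open>r p\<close> do not contribute: the barycentre of the six
  nodes, for example, is such a mixture, so \<open>p, r p, r\<^sup>2 p\<close> is not a \<open>T\<^sub>3\<close> for it.\<close>

definition T3_union ::
  "real^3^3 \<Rightarrow> (3 \<Rightarrow> real^3^3) \<Rightarrow> (3 \<Rightarrow> real^3^3) \<Rightarrow> (real^3^3) set" where
  "T3_union R n n' =
     (\<Union>p \<in> {p \<in> mixture n n' ` weights. is_T3 (orbit3 R p)}. rank_one_hull (range (orbit3 R p)))"

end

theory Submission
  imports Defs
begin

text \<open>For symmetric matrices of equal trace, compatibility of \<open>e\<close> and \<open>f\<close> means \<open>det (e - f) = 0\<close>.
So everything about compatibility can be read off from the determinant, a cubic form which is
preserved by the action \<open>e \<mapsto> R e R\<^sup>T\<close> of rotations. Write \<open>g\<close> for such an action of order three.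

\<^bold>\<open>Symmetric triples.\<close> For \<open>d(l) = det (l p + (1 - l) g p - g\<^sup>2 p)\<close> invariance under \<open>g\<close> gives
\<open>d(1) = - d(0)\<close>, and \<open>d(0) = det (p - g p)\<close>. So as soon as \<open>p\<close> and \<open>g p\<close> are incompatible, \<open>d\<close>
has a zero in \<open>(0,1)\<close>, and by symmetry the same \<open>l\<close> works at all three vertices: \<open>p, g p, g\<^sup>2 p\<close>
is a symmetric \<open>T\<^sub>3\<close>. The cubic \<open>d\<close> is determined by \<open>d(0)\<close> and \<open>d(1/2)\<close> (\<open>inner_det_formula\<close>), so the
zero is unique and is different from \<open>1/2\<close> when \<open>d(1/2) \<noteq> 0\<close>. This last
condition says that the three nodes do not collapse to the barycentre. For the \<open>T\<^sub>3\<close>s of strains,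
\<open>8 d(1/2)\<close> is a polynomial in the lattice parameters, the same for all eight, and it serves as \<open>P\<close>.

\<^bold>\<open>The six nodes.\<close> The dual triple is the image of the triple under a half turn \<open>q\<close> that inverts
\<open>g\<close>. Any node and any dual node are exchanged by one of the involutions \<open>q g\<^sup>k\<close>, which changes
the sign of their difference and hence that of its determinant; so the six nodes are pairwise compatible
(\<open>six_nodes_compatible\<close>). The convex hull of a pairwise compatible finite set is contained in its
lamination hull, since segments parallel to an edge of a simplex join two of its facets
(\<open>convex_hull_subset_lamination_convex\<close>).

\<^bold>\<open>Dimension.\<close> If \<open>v\<close> is the axis of \<open>g\<close>, all six strains and hence all six nodes lie in the
four-dimensional affine space on which the trace and \<open>v \<bullet> e v\<close> are fixed, and they span it.
The hull of the \<open>T\<^sub>3\<close> through \<open>p\<close> with respect to the other rotation \<open>r\<close> contains the triangle of its nodes, so it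
contains a segment through its barycentre \<open>m\<close> in direction \<open>p - m\<close>, whose length depends
continuously on \<open>p\<close>. Scaling towards \<open>m\<close> changes \<open>v \<bullet> e v\<close>, which yields the fifth
dimension (\<open>five_dimensional_union\<close>). The points \<open>p\<close> where this fails lie on the zero set of a polynomial
which does not vanish at the strain shared by the two neighbouring \<open>T\<^sub>3\<close>s.

\<^bold>\<open>Boundary.\<close> For \<open>\<epsilon> \<le> \<delta>\<close> the linear function \<open>v \<bullet> e v\<close> attains its minimum over all twelve
strains on the two dual triples, so the mixtures \<open>p\<close> lie on a supporting hyperplane of the
rank-one convex hull (\<open>frontier_rank_one_hull\<close>).\<close>

section \<open>Compatibility and the determinant\<close>

lemma tensor_nth [simp]: "tensor a b $ i $ j = a $ i * b $ j"
  by (simp add: tensor_def)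

lemma rank_one_if_minors_vanish:
  fixes B :: "real^3^3"
  assumes "\<And>i j k l. B $ i $ j * B $ k $ l = B $ i $ l * B $ k $ j"
  shows "\<exists>u v. B = tensor u v"
proof (cases "B = 0")
  case True
  then have "B = tensor 0 0" by (simp add: vec_eq_iff)
  then show ?thesis by blast
next
  case False
  then obtain i j where ij: "B $ i $ j \<noteq> 0" by (auto simp: vec_eq_iff)
  have "B $ k $ l = B $ k $ j / B $ i $ j * B $ i $ l" for k l
    using assms[of i j k l] ij by (simp add: field_simps)
  then have "B $ k $ l = tensor (\<chi> k. B $ k $ j / B $ i $ j) (B $ i) $ k $ l" for k l
    unfolding tensor_nth vec_lambda_beta by blast
  then have "B = tensor (\<chi> k. B $ k $ j / B $ i $ j) (B $ i)"
    unfolding vec_eq_iff by blast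
  then show ?thesis by blast
qed

text \<open>The conditions on \<open>w = (x, y, z)\<close> say \<open>A w = 0\<close> and \<open>w w\<^sup>T = - adj A\<close> for the symmetric matrix
\<open>A\<close> with diagonal \<open>a, b, c\<close> and off-diagonal entries \<open>p, q, s\<close>. As \<open>det A = 0\<close>, the adjugate has
rank at most one, so \<open>w\<close> is a multiple of any nonzero row of it.\<close>

lemma degenerate_conic_vector:
  fixes a b c p q s :: real
  assumes det: "a*b*c + 2*p*q* s - a* s^2 - b*q^2 - c*p^2 = 0" and neg: "b*c - s^2 < 0"
  obtains x y z where
    "a*x + p*y + q*z = 0" "p*x + b*y + s*z = 0" "q*x + s*y + c*z = 0"
    "x^2 = s^2 - b*c" "y^2 = q^2 - a*c" "z^2 = p^2 - a*b"
    "x*y = p*c - q* s" "x*z = q*b - p* s" "y*z = a* s - p*q"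
proof -
  define r where "r = sqrt (s^2 - b*c)"
  have r2: "r * r = s^2 - b*c" and r: "r \<noteq> 0"
    using neg by (auto simp: r_def)
  define y where "y = (p*c - q* s) / r"
  define z where "z = (q*b - p* s) / r"
  have ry: "r * y = p*c - q* s" and rz: "r * z = q*b - p* s"
    using r by (auto simp: y_def z_def)
  have *: "u = v" if "r * u = r * v" for u v using that r by simp
  have **: "u = v" if "r * (r * u) = r * (r * v)" for u v using that r by simp
  show thesis
  proof (rule that[of r y z])
    show "a*r + p*y + q*z = 0" by (rule *) (use r2 ry rz det in algebra)
    show "p*r + b*y + s*z = 0" by (rule *) (use r2 ry rz det in algebra)
    show "q*r + s*y + c*z = 0" by (rule *) (use r2 ry rz det in algebra)
    show "r^2 = s^2 - b*c" using r2 by (simp add: power2_eq_square)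
    show "y^2 = q^2 - a*c" by (rule **) (use r2 ry rz det in algebra)
    show "z^2 = p^2 - a*b" by (rule **) (use r2 ry rz det in algebra)
    show "r*y = p*c - q* s" "r*z = q*b - p* s" by fact+
    show "y*z = a* s - p*q" by (rule **) (use r2 ry rz det in algebra)
  qed
qed

lemma det_symmetric_part_tensor: "det ((1/2) *\<^sub>R (tensor a b + tensor b a)) = 0" for a b :: "real^3"
  by (simp add: det_3 algebra_simps)

lemma symmetric_nth: "symmetric e \<Longrightarrow> e $ i $ j = e $ j $ i"
  by (simp add: transpose_def vec_eq_iff)

text \<open>The converse direction splits a degenerate conic into two lines: if \<open>A w = 0\<close> and
\<open>w w\<^sup>T = - adj A\<close>, then adding to \<open>A\<close> the skew matrix of \<open>w\<close> gives a matrix of rank one, whose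
symmetric part is \<open>A\<close>. A trace-free \<open>A\<close> has an adjugate of trace at most zero, which makes \<open>w\<close> real.\<close>

lemma compatible_iff_det:
  assumes "symmetric e" "symmetric f" "trace e = trace f"
  shows "compatible e f \<longleftrightarrow> det (e - f) = 0"
proof
  show "det (e - f) = 0" if "compatible e f"
    using that det_symmetric_part_tensor by (auto simp: compatible_def)
next
  assume det0: "det (e - f) = 0"
  define A where "A = e - f"
  define a b c p q s where abc: "a = A $ 1 $ 1" "b = A $ 2 $ 2" "c = A $ 3 $ 3"
    "p = A $ 1 $ 2" "q = A $ 1 $ 3" "s = A $ 2 $ 3"
  have sym: "A $ i $ j = A $ j $ i" for i j
    using symmetric_nth[OF assms(1)] symmetric_nth[OF assms(2)] by (simp add: A_def)
  have det: "a*b*c + 2*p*q* s - a* s^2 - b*q^2 - c*p^2 = 0"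
    using det0 sym[of 1 2] sym[of 1 3] sym[of 2 3]
    by (simp add: A_def[symmetric] det_3 abc power2_eq_square algebra_simps)
  have tr: "a + b + c = 0"
    using assms(3) by (simp add: trace_def sum_3 abc A_def)
  obtain x y z where w:
    "a*x + p*y + q*z = 0" "p*x + b*y + s*z = 0" "q*x + s*y + c*z = 0"
    "x^2 = s^2 - b*c" "y^2 = q^2 - a*c" "z^2 = p^2 - a*b"
    "x*y = p*c - q* s" "x*z = q*b - p* s" "y*z = a* s - p*q"
  proof -
    have nonpos: "(b*c - s^2) + (a*c - q^2) + (a*b - p^2) = - (a^2 + b^2 + c^2)/2 - p^2 - q^2 - s^2"
      using tr by algebra
    consider "b*c - s^2 < 0" | "a*c - q^2 < 0" | "a*b - p^2 < 0"
      | "b*c - s^2 \<ge> 0" "a*c - q^2 \<ge> 0" "a*b - p^2 \<ge> 0" by linarith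
    then show thesis
    proof cases
      case 1
      from degenerate_conic_vector[OF det 1] that show thesis by blast
    next
      case 2
      have "b*a*c + 2*p* s*q - b*q^2 - a* s^2 - c*p^2 = 0" using det by (simp add: algebra_simps)
      then obtain y x z where "b*y + p*x + s*z = 0" "p*y + a*x + q*z = 0" "s*y + q*x + c*z = 0"
        "y^2 = q^2 - a*c" "x^2 = s^2 - b*c" "z^2 = p^2 - b*a"
        "y*x = p*c - s*q" "y*z = s*a - p*q" "x*z = b*q - p* s"
        using degenerate_conic_vector[of b a c p s q] 2 by blast
      then show thesis by (intro that[of x y z]) (simp_all add: algebra_simps)
    next
      case 3
      have "c*b*a + 2* s*q*p - c*p^2 - b*q^2 - a* s^2 = 0" using det by (simp add: algebra_simps)
      moreover have "b*a - p^2 < 0" using 3 by (simp add: mult.commute)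
      ultimately obtain z y x where "c*z + s*y + q*x = 0" "s*z + b*y + p*x = 0" "q*z + p*y + a*x = 0"
        "z^2 = p^2 - b*a" "y^2 = q^2 - c*a" "x^2 = s^2 - c*b"
        "z*y = s*a - q*p" "z*x = q*b - s*p" "y*x = c*p - s*q"
        using degenerate_conic_vector[of c b a s q p] by blast
      then show thesis by (intro that[of x y z]) (simp_all add: algebra_simps)
    next
      case 4
      have sq: "a^2 \<ge> 0" "b^2 \<ge> 0" "c^2 \<ge> 0" "p^2 \<ge> 0" "q^2 \<ge> 0" "s^2 \<ge> 0" by auto
      have "a^2 + b^2 + c^2 + 2 * p^2 + 2 * q^2 + 2 * s^2 \<le> 0"
        using 4 nonpos by argo
      with sq have "a^2 \<le> 0 \<and> b^2 \<le> 0 \<and> c^2 \<le> 0 \<and> p^2 \<le> 0 \<and> q^2 \<le> 0 \<and> s^2 \<le> 0"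
        by argo
      then show thesis by (intro that[of 0 0 0]) auto
    qed
  qed
  define B :: "real^3^3" where
    "B = vector [vector [a, p - z, q + y], vector [p + z, b, s - x], vector [q - y, s + x, c]]"
  have "\<forall>i j k l. B $ i $ j * B $ k $ l = B $ i $ l * B $ k $ j"
    unfolding forall_3 B_def vector_3
    by (intro conjI; insert w; simp add: algebra_simps power2_eq_square; linarith?)
  then obtain u v where uv: "B = tensor u v"
    using rank_one_if_minors_vanish by blast
  have "A = (1/2) *\<^sub>R (B + transpose B)"
    using sym[of 1 2] sym[of 1 3] sym[of 2 3]
    by (simp add: vec_eq_iff forall_3 B_def transpose_def abc)
  also have "transpose B = tensor v u"
    by (simp add: uv vec_eq_iff transpose_def)
  finally show "compatible e f"
    unfolding compatible_def A_def uv by blast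
qed

section \<open>Symmetries of the strain space\<close>

text \<open>Only these properties of the action of a rotation are used, so triples are treated for
abstract linear maps.\<close>

definition strain_symmetry :: "(real^3^3 \<Rightarrow> real^3^3) \<Rightarrow> bool" where
  "strain_symmetry g \<longleftrightarrow> linear g \<and>
     (\<forall>X. det (g X) = det X \<and> trace (g X) = trace X \<and> transpose (g X) = g (transpose X))"

lemma strain_symmetryD:
  assumes "strain_symmetry g"
  shows "linear g" "det (g X) = det X" "trace (g X) = trace X"
    "transpose (g X) = g (transpose X)"
  using assms by (auto simp: strain_symmetry_def)

lemma strain_symmetry_linear_simps:
  assumes "strain_symmetry g"
  shows "g (x + y) = g x + g y" "g (x - y) = g x - g y" "g (c *\<^sub>R x) = c *\<^sub>R g x"
  using strain_symmetryD(1)[OF assms] by (auto simp: linear_add linear_diff linear_cmul)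

lemma strain_symmetry_symmetric:
  "strain_symmetry g \<Longrightarrow> symmetric X \<Longrightarrow> symmetric (g X)"
  by (simp add: strain_symmetryD(4))

lemma strain_symmetry_comp:
  "strain_symmetry g \<Longrightarrow> strain_symmetry h \<Longrightarrow> strain_symmetry (\<lambda>X. g (h X))"
  unfolding strain_symmetry_def using linear_compose[of h g] by (auto simp: o_def)

lemma trace_conj_act:
  assumes "transpose K ** K = mat 1" shows "trace (conj_act K X) = trace X"
proof -
  have "trace (conj_act K X) = trace (transpose K ** (K ** X))"
    unfolding conj_act_def by (rule trace_mul_sym)
  then show ?thesis by (simp add: matrix_mul_assoc assms)
qed

lemma det_conj_act:
  assumes "transpose K ** K = mat 1" shows "det (conj_act K X) = det X"
proof -
  have "det (transpose K) * det K = 1"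
    by (metis assms det_mul det_I)
  then show ?thesis
    by (simp add: conj_act_def det_mul algebra_simps)
qed

lemma linear_conj_act: "linear (conj_act K)"
proof (rule linearI)
  show "conj_act K (x + y) = conj_act K x + conj_act K y" for x y
    unfolding conj_act_def matrix_matrix_mult_def
    by (simp add: vec_eq_iff sum.distrib algebra_simps)
  show "conj_act K (c *\<^sub>R x) = c *\<^sub>R conj_act K x" for c x
    by (simp add: conj_act_def scalar_matrix_assoc matrix_scalar_ac)
qed

lemma strain_symmetry_conj_act:
  assumes "orthogonal_matrix K" shows "strain_symmetry (conj_act K)"
  using assms unfolding strain_symmetry_def orthogonal_matrix
  by (auto simp: linear_conj_act det_conj_act trace_conj_act)
     (simp add: conj_act_def matrix_transpose_mul matrix_mul_assoc)

lemma conj_act_mult: "conj_act (A ** B) X = conj_act A (conj_act B X)"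
  by (simp add: conj_act_def matrix_transpose_mul matrix_mul_assoc)

lemma conj_act_mat_1: "conj_act (mat 1) X = X"
  by (simp add: conj_act_def transpose_mat)

section \<open>The cubic of a threefold orbit\<close>

text \<open>The zeros of this cubic in \<open>l\<close> are the parameters for which the point
\<open>l p + (1 - l) g p\<close> of the edge opposite to \<open>g (g p)\<close> is compatible with \<open>g (g p)\<close>.\<close>

definition inner_det :: "(real^3^3 \<Rightarrow> real^3^3) \<Rightarrow> real^3^3 \<Rightarrow> real \<Rightarrow> real" where
  "inner_det g p l = det (l *\<^sub>R p + (1 - l) *\<^sub>R g p - g (g p))"

lemma det_linear_pencil:
  fixes A B :: "real^3^3"
  obtains c0 c1 c2 c3 where "\<And>l. det (l *\<^sub>R A + B) = c0 + c1 * l + c2 * l^2 + c3 * l^3"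
proof -
  have "\<exists>c0 c1 c2 c3. \<forall>l. det (l *\<^sub>R A + B) = c0 + c1 * l + c2 * l^2 + c3 * l^3"
  proof (intro exI allI)
    fix l
    let ?m = "\<lambda>X Y Z :: real^3^3. det (vector [X$1, Y$2, Z$3] :: real^3^3)"
    show "det (l *\<^sub>R A + B) = ?m B B B + (?m A B B + ?m B A B + ?m B B A) * l
       + (?m A A B + ?m A B A + ?m B A A) * l^2 + ?m A A A * l^3"
      by (simp add: det_3 algebra_simps power2_eq_square power3_eq_cube)
  qed
  then show thesis using that by blast
qed

lemma det_zero: "det (0 :: real^3^3) = 0"
  by (simp add: det_3)

lemma det_minus: "det (- A) = - det A" for A :: "real^3^3"
  by (simp add: det_3 algebra_simps)

lemma det_scaleR: "det (c *\<^sub>R A) = c^3 * det A" for A :: "real^3^3"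
  by (simp add: det_3 algebra_simps power3_eq_cube)

definition threefold :: "(real^3^3 \<Rightarrow> real^3^3) \<Rightarrow> bool" where
  "threefold g \<longleftrightarrow> strain_symmetry g \<and> (\<forall>X. g (g (g X)) = X)"

lemma threefoldD:
  assumes "threefold g"
  shows "strain_symmetry g" "g (g (g X)) = X"
  using assms by (auto simp: threefold_def)

lemma threefold_inverse:
  assumes "threefold g" shows "threefold (\<lambda>X. g (g X))"
  using assms unfolding threefold_def by (auto intro: strain_symmetry_comp)

context
  fixes g assumes g: "threefold g"
begin

lemmas g_sym = threefoldD(1)[OF g]
lemmas g_cube = threefoldD(2)[OF g]
lemmas g_linear = strain_symmetry_linear_simps[OF g_sym]
lemmas g_det = strain_symmetryD(2)[OF g_sym]

lemma inner_det_invariant: "inner_det g (g p) l = inner_det g p l"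
proof -
  have "l *\<^sub>R g p + (1 - l) *\<^sub>R g (g p) - g (g (g p)) = g (l *\<^sub>R p + (1 - l) *\<^sub>R g p - g (g p))"
    by (simp add: g_linear)
  then show ?thesis unfolding inner_det_def by (simp only: g_det)
qed

lemma inner_det_0: "inner_det g p 0 = det (p - g p)"
proof -
  have "g p - g (g p) = g (p - g p)" by (simp add: g_linear)
  then show ?thesis unfolding inner_det_def by (simp add: g_det)
qed

lemma inner_det_1: "inner_det g p 1 = - det (p - g p)"
proof -
  have "p - g (g p) = - g (g (p - g p))" by (simp add: g_linear g_cube)
  then show ?thesis unfolding inner_det_def by (simp add: g_det det_minus)
qed

lemma inner_det_2: "inner_det g p 2 = - 8 * inner_det g p (1/2)"
proof -
  have "2 *\<^sub>R p + (1 - 2) *\<^sub>R g p - g (g p)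
      = (- 2) *\<^sub>R g ((1/2) *\<^sub>R p + (1 - 1/2) *\<^sub>R g p - g (g p))"
    by (simp add: g_linear g_cube algebra_simps)
  then show ?thesis unfolding inner_det_def by (simp only: g_det det_scaleR) simp
qed

text \<open>A cubic is determined by its values at \<open>0\<close>, \<open>1\<close>, \<open>1/2\<close> and \<open>2\<close>. Threefold symmetry ties
the value at \<open>1\<close> to that at \<open>0\<close> and the value at \<open>2\<close> to that at \<open>1/2\<close>.\<close>

lemma inner_det_formula:
  "inner_det g p l = det (p - g p) * (2 - l) * (1 - 2 * l) * (1 + l) / 2 + 4 * inner_det g p (1/2) * l * (1 - l)"
proof -
  obtain c0 c1 c2 c3 where
    c: "\<And>l. det (l *\<^sub>R (p - g p) + (g p - g (g p))) = c0 + c1 * l + c2 * l^2 + c3 * l^3"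
    using det_linear_pencil by blast
  have inner_det: "inner_det g p l = c0 + c1 * l + c2 * l^2 + c3 * l^3" for l
    unfolding inner_det_def c[symmetric] by (rule arg_cong[of _ _ det]) (simp add: algebra_simps)
  have "c0 + c1 + c2 + c3 = - det (p - g p)" "c0 = det (p - g p)"
    "c0 + c1 * 2 + c2 * 4 + c3 * 8 = - 8 * inner_det g p (1/2)"
    using inner_det[of 1] inner_det[of 0] inner_det[of 2] by (simp_all add: inner_det_0 inner_det_1 inner_det_2)
  moreover have "inner_det g p (1/2) = c0 + c1 / 2 + c2 / 4 + c3 / 8"
    using inner_det[of "1/2"] by (simp add: power2_eq_square power3_eq_cube)
  ultimately show ?thesis
    unfolding inner_det[of l] by algebra
qed

lemma inner_det_root_exists:
  assumes "det (p - g p) \<noteq> 0"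
  obtains l where "0 < l" "l < 1" "inner_det g p l = 0"
proof -
  let ?d = "det (p - g p)"
  have eq: "inner_det g p = (\<lambda>l. ?d * (2 - l) * (1 - 2 * l) * (1 + l) / 2 + 4 * inner_det g p (1/2) * l * (1 - l))"
    by (rule ext) (rule inner_det_formula)
  have "continuous_on {0..1}
      (\<lambda>l. ?d * (2 - l) * (1 - 2 * l) * (1 + l) / 2 + 4 * inner_det g p (1/2) * l * (1 - l))"
    by (intro continuous_intros) auto
  then have "continuous_on {0..1} (inner_det g p)" by (subst eq)
  then have cont: "continuous_on {0..1} (\<lambda>l. inner_det g p l / ?d)"
    using assms by (intro continuous_intros) auto
  have "\<exists>l\<ge>0. l \<le> 1 \<and> inner_det g p l / ?d = 0"
    by (rule IVT2') (use assms cont in \<open>auto simp: inner_det_0 inner_det_1\<close>)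
  then obtain l where l: "0 \<le> l" "l \<le> 1" "inner_det g p l = 0" using assms by auto
  moreover have "l \<noteq> 0" "l \<noteq> 1" using l(3) assms by (auto simp: inner_det_0 inner_det_1)
  ultimately show thesis by (intro that[of l]) auto
qed

text \<open>Divided by \<open>l (1 - l)\<close>, the cubic is a constant plus a nonzero multiple of a strictly decreasing function.\<close>

lemma inner_det_root_unique:
  assumes "det (p - g p) \<noteq> 0"
    and "0 < l" "l < 1" "inner_det g p l = 0" and "0 < k" "k < 1" "inner_det g p k = 0"
  shows "l = k"
proof -
  let ?d = "det (p - g p)" and ?h = "inner_det g p (1/2)"
  \<comment> \<open>\<open>ps x = (2 - x) (1 - 2 x) (1 + x) / (x (1 - x))\<close> in partial fractions\<close>
  define ps where "ps x = (1 - 2 * x) + 2 * (1 / x - 1 / (1 - x))" for x :: real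
  have ps: "?d * ps x = - 8 * ?h" if "0 < x" "x < 1" "inner_det g p x = 0" for x
  proof -
    have "x * (1 - x) * ps x = (2 - x) * (1 - 2 * x) * (1 + x)"
      using that by (simp add: ps_def field_simps)
    then have "x * (1 - x) * (?d * ps x) = x * (1 - x) * (- 8 * ?h)"
      using that(3) inner_det_formula[of p x] by algebra
    moreover have "x * (1 - x) \<noteq> 0" using that by simp
    ultimately show ?thesis using mult_left_cancel by blast
  qed
  have less: "ps y < ps x" if "0 < x" "x < y" "y < 1" for x y
  proof -
    have "1 / y < 1 / x" "1 / (1 - x) < 1 / (1 - y)" using that by (auto simp: frac_less2)
    then show ?thesis using that by (simp add: ps_def)
  qed
  have "?d * ps l = ?d * ps k" using ps assms by metis
  then have "ps l = ps k" using assms(1) by simp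
  then show ?thesis using less assms by (metis less_irrefl linorder_neqE)
qed

text \<open>The nodes spread as far as the root is away from \<open>1/2\<close>. This lower bound is continuous in \<open>p\<close>,
although the root is only given implicitly.\<close>

lemma inner_det_root_away_from_half:
  assumes "det (p - g p) \<noteq> 0" "0 < l" "l < 1" "inner_det g p l = 0"
  shows "\<bar>inner_det g p (1/2)\<bar> \<le> \<bar>1 - 2 * l\<bar> * (2 * \<bar>det (p - g p)\<bar> + \<bar>inner_det g p (1/2)\<bar>)"
proof -
  let ?d = "det (p - g p)" and ?h = "inner_det g p (1/2)"
  \<comment> \<open>in terms of \<open>u\<close> the cubic is \<open>d u (9 - u\<^sup>2) / 8 + h (1 - u\<^sup>2)\<close>\<close>
  define u where "u = 1 - 2 * l"
  have "\<bar>u\<bar> \<le> 1" using assms by (auto simp: u_def)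
  then have u: "\<bar>u\<bar> \<le> 1" "u^2 \<le> 1" by (auto simp: abs_square_le_1)
  have "?h * (1 - u^2) = - ?d * u * (9 - u^2) / 8"
    using assms(4) inner_det_formula[of p l] unfolding u_def by algebra
  then have "\<bar>?h * (1 - u^2)\<bar> = \<bar>- ?d * u * (9 - u^2) / 8\<bar>" by simp
  then have "\<bar>?h\<bar> * (1 - u^2) = \<bar>?d\<bar> * \<bar>u\<bar> * ((9 - u^2) / 8)"
    using u by (simp add: abs_mult)
  also have "\<dots> \<le> \<bar>?d\<bar> * \<bar>u\<bar> * 2"
    using zero_le_power2[of u] by (intro mult_left_mono; argo?) auto
  finally have "\<bar>?h\<bar> \<le> \<bar>?d\<bar> * \<bar>u\<bar> * 2 + \<bar>?h\<bar> * u^2" by (simp add: algebra_simps)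
  also have "u^2 \<le> \<bar>u\<bar>" using u(1) mult_left_le[of "\<bar>u\<bar>" "\<bar>u\<bar>"] by (simp add: power2_eq_square)
  then have "\<bar>?h\<bar> * u^2 \<le> \<bar>?h\<bar> * \<bar>u\<bar>" by (intro mult_left_mono) auto
  finally show ?thesis by (simp add: u_def algebra_simps)
qed

end

text \<open>Reversing the cyclic order of the triple exchanges \<open>l\<close> and \<open>1 - l\<close>. This reduces most
statements about nodes to \<open>l < 1/2\<close> or to one labelling.\<close>

lemma inner_det_inverse:
  assumes "threefold g" shows "inner_det (\<lambda>X. g (g X)) p (1 - l) = inner_det g p l"
proof -
  note lin = strain_symmetry_linear_simps[OF threefoldD(1)[OF assms]]
  have "l *\<^sub>R p + (1 - l) *\<^sub>R g p - g (g p)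
    = g ((1 - l) *\<^sub>R p + (1 - (1 - l)) *\<^sub>R g (g p) - g (g (g (g p))))"
    by (simp add: lin threefoldD(2)[OF assms])
  then show ?thesis
    unfolding inner_det_def by (simp only: strain_symmetryD(2)[OF threefoldD(1)[OF assms]])
qed

section \<open>Hulls\<close>

lemma compatible_scaleR:
  assumes "compatible x y" "u - v = c *\<^sub>R (x - y)"
  shows "compatible u v"
proof -
  obtain a b where "x - y = (1/2) *\<^sub>R (tensor a b + tensor b a)"
    using assms(1) by (auto simp: compatible_def)
  then have "u - v = (1/2) *\<^sub>R (tensor (c *\<^sub>R a) b + tensor b (c *\<^sub>R a))"
    by (simp add: assms(2) vec_eq_iff algebra_simps)
  then show ?thesis unfolding compatible_def by blast
qed

text \<open>Through a point of a simplex draw the line parallel to the edge between two vertices \<open>x\<close> and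
\<open>y\<close>. It meets the facets opposite to \<open>x\<close> and to \<open>y\<close>, and these belong to \<open>W\<close> by induction. The two points of
intersection differ by a multiple of \<open>x - y\<close>, so they are compatible.\<close>

lemma convex_hull_subset_lamination_convex:
  assumes "finite S" "\<And>x y. x \<in> S \<Longrightarrow> y \<in> S \<Longrightarrow> compatible x y" "lamination_convex W" "S \<subseteq> W"
  shows "convex hull S \<subseteq> W"
  using assms
proof (induction "card S" arbitrary: S rule: less_induct)
  case less
  show ?case
  proof (cases "\<exists>x\<in>S. \<exists>y\<in>S. x \<noteq> y")
    case False
    then consider "S = {}" | x where "S = {x}" by blast
    then show ?thesis using less.prems(4) by cases auto
  next
    case True
    then obtain x y where xy: "x \<in> S" "y \<in> S" "x \<noteq> y" by blast
    have IH: "convex hull (S - {z}) \<subseteq> W" if "z \<in> S" for z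
      using less.hyps[OF card_Diff1_less[OF less.prems(1) that]] less.prems by auto
    show ?thesis
    proof
      fix p assume "p \<in> convex hull S"
      then obtain u where u: "\<And>z. z \<in> S \<Longrightarrow> 0 \<le> u z" "sum u S = 1" "(\<Sum>z\<in>S. u z *\<^sub>R z) = p"
        unfolding convex_hull_finite[OF less.prems(1)] by blast
      define s where "s = u x + u y"
      define q where "q = (\<Sum>z\<in>S-{x,y}. u z *\<^sub>R z)"
      have split: "sum h S = h x + h y + sum h (S - {x,y})" for h :: "real^3^3 \<Rightarrow> 'b::ab_group_add"
        using xy less.prems(1)
        by (simp add: sum.remove[of S x] sum.remove[of "S - {x}" y] Diff_insert[symmetric] insert_commute add.assoc)
      have p: "p = u x *\<^sub>R x + u y *\<^sub>R y + q" using u(3) by (simp add: split q_def)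
      have mem: "s *\<^sub>R v + q \<in> W" if v: "v \<in> S" "w \<in> S" "{v, w} = {x, y}" "v \<noteq> w" for v w
      proof -
        have fin: "finite (S - {w})" using less.prems(1) by simp
        define u' where "u' = (\<lambda>z. if z = v then s else u z)"
        have Sw: "S - {w} = insert v (S - {x,y})" "v \<notin> S - {x,y}" using v by auto
        have u': "u' v = s" "\<And>z. z \<in> S - {x,y} \<Longrightarrow> u' z = u z"
          using Sw(2) by (auto simp: u'_def)
        have eq: "(\<Sum>z\<in>S-{w}. u' z *\<^sub>R z) = s *\<^sub>R v + q"
          unfolding Sw(1) using Sw(2) less.prems(1) u' by (simp add: q_def)
        have "sum u' (S - {w}) = s + sum u (S - {x,y})"
          unfolding Sw(1) using Sw(2) less.prems(1) u' by simp
        then have one: "sum u' (S - {w}) = 1" using u(2) by (simp add: split s_def)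
        have "\<forall>z\<in>S-{w}. 0 \<le> u' z" using u(1) xy by (auto simp: u'_def s_def)
        then have "s *\<^sub>R v + q \<in> convex hull (S - {w})"
          unfolding convex_hull_finite[OF fin] using eq one by blast
        then show ?thesis using IH v by blast
      qed
      have W: "s *\<^sub>R x + q \<in> W" "s *\<^sub>R y + q \<in> W"
        using mem[of x y] mem[of y x] xy by auto
      have "compatible (s *\<^sub>R x + q) (s *\<^sub>R y + q)"
        by (rule compatible_scaleR[OF less.prems(2)[OF xy(1,2)], of _ _ s]) (simp add: algebra_simps)
      then have seg: "closed_segment (s *\<^sub>R x + q) (s *\<^sub>R y + q) \<subseteq> W"
        using W less.prems(3) unfolding lamination_convex_def by blast
      show "p \<in> W"
      proof (cases "s = 0")
        case True
        then have "u x = 0" "u y = 0" using u(1)[OF xy(1)] u(1)[OF xy(2)] by (auto simp: s_def)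
        then show ?thesis using W(1) p True by simp
      next
        case False
        then have s: "s > 0" using u(1)[OF xy(1)] u(1)[OF xy(2)] by (auto simp: s_def)
        have "p = (1 - u y / s) *\<^sub>R (s *\<^sub>R x + q) + (u y / s) *\<^sub>R (s *\<^sub>R y + q)"
        proof -
          have "(1 - r) *\<^sub>R (s *\<^sub>R x + q) + r *\<^sub>R (s *\<^sub>R y + q) = (s - r * s) *\<^sub>R x + (r * s) *\<^sub>R y + q"
            for r by (simp add: algebra_simps)
          from this[of "u y / s"] show ?thesis using s by (simp add: p) (simp add: s_def)
        qed
        moreover have "0 \<le> u y / s" "u y / s \<le> 1"
          using s u(1)[OF xy(1)] u(1)[OF xy(2)] by (auto simp: s_def)
        ultimately show ?thesis using seg unfolding closed_segment_def by blast
      qed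
    qed
  qed
qed

lemma convex_hull_subset_lamination_hull:
  assumes "finite S" "\<And>x y. x \<in> S \<Longrightarrow> y \<in> S \<Longrightarrow> compatible x y"
  shows "convex hull S \<subseteq> lamination_hull S"
  unfolding lamination_hull_def hull_def[of lamination_convex]
  by (rule Inter_greatest) (use convex_hull_subset_lamination_convex[OF assms] in auto)

lemma rank_one_hullI:
  assumes "symmetric e" "\<And>f. sym_rank_one_convex f \<Longrightarrow> f e \<le> (SUP x\<in>E. f x)"
  shows "e \<in> rank_one_hull E"
  using assms by (auto simp: rank_one_hull_def)

lemma rank_one_hullD:
  assumes "e \<in> rank_one_hull E"
  shows "symmetric e" "sym_rank_one_convex f \<Longrightarrow> f e \<le> (SUP x\<in>E. f x)"
  using assms by (auto simp: rank_one_hull_def)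

lemma rank_one_hull_inc:
  assumes "finite E" "x \<in> E" "symmetric x"
  shows "x \<in> rank_one_hull E"
  using assms by (intro rank_one_hullI cSUP_upper) auto

lemma lamination_convex_rank_one_hull: "lamination_convex (rank_one_hull E)"
  unfolding lamination_convex_def
proof (intro ballI impI subsetI)
  fix x y z assume x: "x \<in> rank_one_hull E" and y: "y \<in> rank_one_hull E"
    and c: "compatible x y" and z: "z \<in> closed_segment x y"
  obtain u where u: "0 \<le> u" "u \<le> 1" "z = u *\<^sub>R x + (1 - u) *\<^sub>R y"
  proof -
    from z obtain v where "0 \<le> v" "v \<le> 1" "z = (1 - v) *\<^sub>R x + v *\<^sub>R y"
      unfolding in_segment by blast
    then show thesis by (intro that[of "1 - v"]) auto
  qed
  show "z \<in> rank_one_hull E"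
  proof (rule rank_one_hullI)
    show "symmetric z"
      using rank_one_hullD(1)[OF x] rank_one_hullD(1)[OF y]
      by (simp add: u(3) vec_eq_iff transpose_def)
    fix f :: "real^3^3 \<Rightarrow> real" assume f: "sym_rank_one_convex f"
    let ?M = "SUP x\<in>E. f x"
    have "f z \<le> u * f x + (1 - u) * f y"
      using f c u rank_one_hullD(1)[OF x] rank_one_hullD(1)[OF y]
      unfolding sym_rank_one_convex_def by blast
    also have "\<dots> \<le> u * ?M + (1 - u) * ?M"
      using rank_one_hullD(2)[OF x f] rank_one_hullD(2)[OF y f] u
      by (intro add_mono mult_left_mono) auto
    finally show "f z \<le> ?M" by (simp add: algebra_simps)
  qed
qed

lemma rank_one_hull_minimal:
  assumes "S \<subseteq> rank_one_hull E" "S \<noteq> {}"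
  shows "rank_one_hull S \<subseteq> rank_one_hull E"
proof
  fix e assume e: "e \<in> rank_one_hull S"
  show "e \<in> rank_one_hull E"
  proof (rule rank_one_hullI)
    show "symmetric e" by (rule rank_one_hullD[OF e])
    fix f :: "real^3^3 \<Rightarrow> real" assume f: "sym_rank_one_convex f"
    have "f e \<le> (SUP x\<in>S. f x)" by (rule rank_one_hullD(2)[OF e f])
    also have "\<dots> \<le> (SUP x\<in>E. f x)"
      using assms rank_one_hullD(2)[OF _ f] by (intro cSUP_least) auto
    finally show "f e \<le> (SUP x\<in>E. f x)" .
  qed
qed

lemma rank_one_hull_linear_bound:
  fixes L :: "real^3^3 \<Rightarrow> real"
  assumes "linear L" "\<And>x. x \<in> E \<Longrightarrow> c \<le> L x" "E \<noteq> {}" "e \<in> rank_one_hull E"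
  shows "c \<le> L e"
proof -
  have "sym_rank_one_convex (\<lambda>x. - L x)"
    using assms(1) by (simp add: sym_rank_one_convex_def linear_add linear_cmul)
  from rank_one_hullD(2)[OF assms(4) this] have "- L e \<le> (SUP x\<in>E. - L x)" .
  also have "\<dots> \<le> - c" using assms by (intro cSUP_least) auto
  finally show ?thesis by simp
qed

lemma linear_trace: "linear (trace :: real^3^3 \<Rightarrow> real)"
  by (rule linearI) (simp_all add: trace_def sum_3 algebra_simps)

lemma rank_one_hull_trace_space:
  assumes "E \<subseteq> trace_space t" "E \<noteq> {}"
  shows "rank_one_hull E \<subseteq> trace_space t"
proof
  fix e assume e: "e \<in> rank_one_hull E"
  have "t \<le> trace e"
    by (rule rank_one_hull_linear_bound[OF linear_trace _ assms(2) e])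
       (use assms in \<open>auto simp: trace_space_def\<close>)
  moreover have "- t \<le> - trace e"
    by (rule rank_one_hull_linear_bound[OF linear_compose_neg[OF linear_trace] _ assms(2) e])
       (use assms in \<open>auto simp: trace_space_def\<close>)
  ultimately show "e \<in> trace_space t"
    using rank_one_hullD(1)[OF e] by (simp add: trace_space_def)
qed

section \<open>Nodes\<close>

text \<open>The intersection point of the segments from \<open>a\<close> and from \<open>g a\<close> to their inner points, in
barycentric coordinates with respect to \<open>a, g a, g (g a)\<close>.\<close>

definition node :: "(real^3^3 \<Rightarrow> real^3^3) \<Rightarrow> real \<Rightarrow> real^3^3 \<Rightarrow> real^3^3" where
  "node g l a = (1 / (1 - l + l^2)) *\<^sub>R ((1 - l)^2 *\<^sub>R a + l^2 *\<^sub>R g a + (l * (1 - l)) *\<^sub>R g (g a))"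

lemma node_denominator_pos: "0 < 1 - l + l^2" for l :: real
proof -
  have "1 - l + l^2 = (l - 1/2)^2 + 3/4" by (simp add: power2_eq_square algebra_simps)
  then show ?thesis using zero_le_power2[of "l - 1/2"] by linarith
qed

definition orbit_set :: "(real^3^3 \<Rightarrow> real^3^3) \<Rightarrow> real^3^3 \<Rightarrow> (real^3^3) set" where
  "orbit_set g p = {p, g p, g (g p)}"

context
  fixes g assumes g: "threefold g"
begin

interpretation L: linear g using g by (simp add: threefold_def strain_symmetry_def)

lemma node_equivariant: "g (node g l a) = node g l (g a)"
  by (simp add: node_def L.scale L.add)

lemma node_inverse: "node (\<lambda>X. g (g X)) (1 - l) a = node g l (g (g a))"
proof -
  have "1 - (1 - l) + (1 - l)^2 = 1 - l + l^2" by (simp add: power2_eq_square algebra_simps)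
  then show ?thesis
    unfolding node_def by (simp add: threefoldD[OF g] add_ac mult.commute)
qed

lemma orbit_set_inverse: "orbit_set (\<lambda>X. g (g X)) p = orbit_set g p"
  by (auto simp: orbit_set_def threefoldD[OF g])

lemma orbit_set_closed: "x \<in> orbit_set g p \<Longrightarrow> g x \<in> orbit_set g p"
  by (auto simp: orbit_set_def threefoldD[OF g])

text \<open>If a combination of \<open>d = a - g a\<close> and \<open>g d\<close> vanishes, then so does its image under \<open>g\<close>, where
\<open>g (g d) = - d - g d\<close>. The determinant of the resulting two equations is the
definite form \<open>x\<^sup>2 + x y + y\<^sup>2\<close>.\<close>

lemma orbit_independent:
  assumes "x *\<^sub>R a + y *\<^sub>R g a + z *\<^sub>R g (g a) = 0" "x + y + z = 0" "a \<noteq> g a"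
  shows "x = 0" "y = 0" "z = 0"
proof -
  define d where "d = a - g a"
  have gd: "g d = g a - g (g a)" "g (g d) = - d - g d"
    by (simp_all add: d_def L.diff threefoldD[OF g])
  have z: "z = - x - y" using assms(2) by simp
  have 1: "x *\<^sub>R d + (x + y) *\<^sub>R g d = 0"
    using assms(1) unfolding z gd(1) unfolding d_def by (simp add: algebra_simps)
  then have "g (x *\<^sub>R d + (x + y) *\<^sub>R g d) = 0" by (simp add: L.zero)
  then have *: "x *\<^sub>R g d + (x + y) *\<^sub>R (- d - g d) = 0"
    by (simp add: L.add L.scale gd(2))
  have "(x + y) *\<^sub>R d + y *\<^sub>R g d = - (x *\<^sub>R g d + (x + y) *\<^sub>R (- d - g d))"
    by (simp add: algebra_simps)
  with * have 2: "(x + y) *\<^sub>R d + y *\<^sub>R g d = 0" by simp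
  have "(x^2 + x*y + y^2) *\<^sub>R g d
      = (x + y) *\<^sub>R (x *\<^sub>R d + (x + y) *\<^sub>R g d) - x *\<^sub>R ((x + y) *\<^sub>R d + y *\<^sub>R g d)"
    by (simp add: vec_eq_iff) (simp add: algebra_simps power2_eq_square)
  then have 3: "(x^2 + x*y + y^2) *\<^sub>R g d = 0"
    unfolding 1 2 by simp
  have "g d \<noteq> 0"
  proof
    assume "g d = 0"
    then have "g (g (g d)) = 0" by (simp add: L.zero)
    then show False using assms(3) by (simp add: threefoldD[OF g] d_def)
  qed
  then have "x^2 + x*y + y^2 = 0" using 3 by simp
  moreover have "4 * (x^2 + x*y + y^2) = (2*x + y)^2 + 3*y^2" by algebra
  ultimately have "(2*x + y)^2 + 3*y^2 = 0" by simp
  then have "y = 0" "2*x + y = 0" by (auto simp: add_nonneg_eq_0_iff)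
  then show "x = 0" "y = 0" "z = 0" using z by auto
qed

lemma det_orbit_differences:
  assumes "x \<in> orbit_set g p" "y \<in> orbit_set g p" "x \<noteq> y" "det (p - g p) \<noteq> 0"
  shows "det (x - y) \<noteq> 0"
proof -
  have 1: "det (p - g p) = det (g p - g (g p))"
    using strain_symmetryD(2)[OF threefoldD(1)[OF g], of "p - g p"] by (simp add: L.diff)
  have "det (g (g p) - p) = det (g p - g (g p))"
    using strain_symmetryD(2)[OF threefoldD(1)[OF g], of "g p - g (g p)"]
    by (simp add: L.diff threefoldD[OF g])
  with 1 have 2: "det (p - g p) = det (g (g p) - p)" by simp
  have m: "det (a - b) = - det (b - a)" for a b :: "real^3^3"
    using det_minus[of "b - a"] by simp
  show ?thesis
    using assms 1 2 m[of "g p" p] m[of "g (g p)" "g p"] m[of p "g (g p)"]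
    by (auto simp: orbit_set_def)
qed

lemma compatible_node:
  assumes "symmetric p" "inner_det g p l = 0"
  shows "compatible (node g l p) (g p)"
proof -
  define D where "D = 1 - l + l^2"
  have D: "D \<noteq> 0" using node_denominator_pos[of l] by (simp add: D_def)
  have s: "symmetric (g p)" "symmetric (g (g p))"
    using assms strain_symmetry_symmetric threefoldD(1)[OF g] by blast+
  have "node g l p - g p = ((1 - l) / D) *\<^sub>R ((1 - l) *\<^sub>R p + l *\<^sub>R g (g p) - g p)"
  proof -
    have "(1 - l)^2 *\<^sub>R p + l^2 *\<^sub>R g p + (l * (1 - l)) *\<^sub>R g (g p) - D *\<^sub>R g p
      = (1 - l) *\<^sub>R ((1 - l) *\<^sub>R p + l *\<^sub>R g (g p) - g p)"
      by (simp add: D_def vec_eq_iff algebra_simps power2_eq_square)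
    then have "(1 / D) *\<^sub>R ((1 - l)^2 *\<^sub>R p + l^2 *\<^sub>R g p + (l * (1 - l)) *\<^sub>R g (g p) - D *\<^sub>R g p)
      = (1 / D) *\<^sub>R ((1 - l) *\<^sub>R ((1 - l) *\<^sub>R p + l *\<^sub>R g (g p) - g p))" by (rule arg_cong)
    then show ?thesis
      using D unfolding node_def D_def[symmetric] scaleR_diff_right by simp
  qed
  moreover have "compatible ((1 - l) *\<^sub>R p + l *\<^sub>R g (g p)) (g p)"
  proof (subst compatible_iff_det)
    have "g ((1 - l) *\<^sub>R p + l *\<^sub>R g (g p) - g p) = l *\<^sub>R p + (1 - l) *\<^sub>R g p - g (g p)"
      by (simp add: L.add L.diff L.scale threefoldD[OF g])
    then show "det ((1 - l) *\<^sub>R p + l *\<^sub>R g (g p) - g p) = 0"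
      using assms(2) strain_symmetryD(2)[OF threefoldD(1)[OF g], symmetric] unfolding inner_det_def by metis
    show "symmetric ((1 - l) *\<^sub>R p + l *\<^sub>R g (g p))"
      using assms(1) s by (simp add: vec_eq_iff transpose_def)
    show "trace ((1 - l) *\<^sub>R p + l *\<^sub>R g (g p)) = trace (g p)"
      using strain_symmetryD(3)[OF threefoldD(1)[OF g]] linear_trace
      by (simp only: linear_add linear_cmul) (simp add: algebra_simps)
  qed (use s in auto)
  ultimately show ?thesis using compatible_scaleR by metis
qed

text \<open>The segment from \<open>g p\<close> to its inner point contains two of the nodes.\<close>

lemma node_step:
  assumes "0 < l" "l < 1"
  shows "g (node g l p) = (l / (1 - l)) *\<^sub>R node g l p + (1 - l / (1 - l)) *\<^sub>R g p"
proof -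
  define D where "D = 1 - l + l^2"
  have D: "D \<noteq> 0" using node_denominator_pos[of l] by (simp add: D_def)
  define m where "m = 1 - l"
  have m: "m \<noteq> 0" using assms by (simp add: m_def)
  have "(m * D) *\<^sub>R g (node g l p) = (m * D) *\<^sub>R ((l / m) *\<^sub>R node g l p + (1 - l / m) *\<^sub>R g p)"
  proof -
    have "D *\<^sub>R node g l x = m^2 *\<^sub>R x + l^2 *\<^sub>R g x + (l * m) *\<^sub>R g (g x)" for x
      using D by (simp add: node_def D_def m_def)
    note n = this[of p] this[of "g p"]
    have "(m * D) *\<^sub>R g (node g l p) = m *\<^sub>R (m^2 *\<^sub>R g p + l^2 *\<^sub>R g (g p) + (l * m) *\<^sub>R p)"
      using n(2) by (simp add: node_equivariant threefoldD[OF g] flip: scaleR_scaleR)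
    also have "\<dots> = l *\<^sub>R (m^2 *\<^sub>R p + l^2 *\<^sub>R g p + (l * m) *\<^sub>R g (g p)) + (D * (m - l)) *\<^sub>R g p"
    proof -
      have "D * (m - l) = m^3 - l^3" by (simp add: D_def m_def) algebra
      then show ?thesis by (simp add: vec_eq_iff) (simp add: algebra_simps power2_eq_square power3_eq_cube)
    qed
    also have "\<dots> = (l * D) *\<^sub>R node g l p + (D * (m - l)) *\<^sub>R g p"
      using n(1) by (simp flip: scaleR_scaleR)
    also have "\<dots> = (m * D) *\<^sub>R ((l / m) *\<^sub>R node g l p + (1 - l / m) *\<^sub>R g p)"
      using m by (simp add: scaleR_add_right algebra_simps)
    finally show ?thesis .
  qed
  then show ?thesis using m D by (simp add: m_def)
qed

text \<open>Each node lies between a vertex and the preceding node. Hence a rank-one convex function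
that is at most \<open>M\<close> at the vertices exceeds \<open>M\<close> at a node by at most \<open>c\<close> times its excess at the preceding
one, with \<open>c < 1\<close>; going once around the cycle shows that there is no excess.\<close>

lemma node_in_hull_lt:
  assumes p: "symmetric p" and l: "0 < l" "l < 1/2" "inner_det g p l = 0"
    and x: "x \<in> orbit_set g p"
  shows "node g l x \<in> rank_one_hull (orbit_set g p)"
proof (rule rank_one_hullI)
  have s: "symmetric y" if "y \<in> orbit_set g p" for y
    using that p strain_symmetry_symmetric threefoldD(1)[OF g] by (auto simp: orbit_set_def)
  have symn: "symmetric (node g l y)" if "y \<in> orbit_set g p" for y
    using s[OF that] s[OF orbit_set_closed[OF that]]
      s[OF orbit_set_closed[OF orbit_set_closed[OF that]]]
    by (simp add: node_def vec_eq_iff transpose_def)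
  show "symmetric (node g l x)" using symn x .
  fix f :: "real^3^3 \<Rightarrow> real" assume f: "sym_rank_one_convex f"
  define M where "M = (SUP x\<in>orbit_set g p. f x)"
  define c where "c = l / (1 - l)"
  have c: "0 \<le> c" "c < 1" using l by (auto simp: c_def field_simps)
  have M: "f y \<le> M" if "y \<in> orbit_set g p" for y
    unfolding M_def using that by (intro cSUP_upper) (auto simp: orbit_set_def)
  have step: "f (node g l (g y)) - M \<le> c * (f (node g l y) - M)" if y: "y \<in> orbit_set g p" for y
  proof -
    have "inner_det g y l = 0" using y l(3) inner_det_invariant[OF g] by (auto simp: orbit_set_def)
    then have "compatible (node g l y) (g y)" using compatible_node s y by blast
    then have "f (c *\<^sub>R node g l y + (1 - c) *\<^sub>R g y) \<le> c * f (node g l y) + (1 - c) * f (g y)"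
      using f c symn[OF y] s[OF orbit_set_closed[OF y]] unfolding sym_rank_one_convex_def by auto
    also have "\<dots> \<le> c * f (node g l y) + (1 - c) * M"
      using M[OF orbit_set_closed[OF y]] c by (intro add_left_mono mult_left_mono) auto
    finally have "f (c *\<^sub>R node g l y + (1 - c) *\<^sub>R g y) - M \<le> c * (f (node g l y) - M)"
      by (simp add: algebra_simps)
    moreover have "node g l (g y) = c *\<^sub>R node g l y + (1 - c) *\<^sub>R g y"
      using node_step[of l y] l unfolding c_def node_equivariant by simp
    ultimately show ?thesis by simp
  qed
  have "f (node g l x) - M \<le> c * (c * (c * (f (node g l x) - M)))"
  proof -
    note x1 = orbit_set_closed[OF x] and x2 = orbit_set_closed[OF orbit_set_closed[OF x]]
    have "f (node g l x) - M \<le> c * (f (node g l (g (g x))) - M)"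
      using step[OF x2] by (simp add: threefoldD[OF g])
    also have "\<dots> \<le> c * (c * (f (node g l (g x)) - M))"
      using step[OF x1] c by (intro mult_left_mono) auto
    also have "\<dots> \<le> c * (c * (c * (f (node g l x) - M)))"
      using step[OF x] c by (intro mult_left_mono) auto
    finally show ?thesis .
  qed
  then have "(1 - c^3) * (f (node g l x) - M) \<le> 0"
    by (simp add: power3_eq_cube algebra_simps)
  moreover have "c^3 < 1" using c by (simp add: power_less_one_iff)
  ultimately show "f (node g l x) \<le> M" by (simp add: mult_le_0_iff)
qed

end

lemma node_in_hull:
  assumes g: "threefold g" and p: "symmetric p" and l: "0 < l" "l < 1" "l \<noteq> 1/2" "inner_det g p l = 0"
    and x: "x \<in> orbit_set g p"
  shows "node g l x \<in> rank_one_hull (orbit_set g p)"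
proof (cases "l < 1/2")
  case True
  then show ?thesis using node_in_hull_lt assms by blast
next
  case False
  let ?g = "\<lambda>X. g (g X)"
  have "g x \<in> orbit_set ?g p"
    using orbit_set_closed[OF g x] by (simp add: orbit_set_inverse[OF g])
  moreover have "inner_det ?g p (1 - l) = 0" using inner_det_inverse[OF g] l by simp
  ultimately have "node ?g (1 - l) (g x) \<in> rank_one_hull (orbit_set ?g p)"
    using l False p by (intro node_in_hull_lt threefold_inverse g) auto
  then show ?thesis by (simp add: node_inverse[OF g] orbit_set_inverse[OF g] threefoldD[OF g])
qed

section \<open>Triples\<close>

lemma three_cycle: "(i::3) + 1 + 1 = i + 2" "(i::3) + 2 + 1 = i" "(i::3) + 1 + 2 = i"
proof -
  show "(i::3) + 1 + 1 = i + 2" by (simp add: add.assoc)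
  have "(1::3) + 2 = 0" "(2::3) + 1 = 0" by simp_all
  then show "(i::3) + 2 + 1 = i" "(i::3) + 1 + 2 = i" by (simp_all add: add.assoc)
qed

lemma symmetric_orbit:
  assumes "threefold g" "symmetric p" "x \<in> orbit_set g p"
  shows "symmetric x"
  using assms strain_symmetry_symmetric threefoldD(1) by (auto simp: orbit_set_def)

context
  fixes g and e :: "3 \<Rightarrow> real^3^3"
  assumes g: "threefold g" and cyc: "\<And>i. e (i + 1) = g (e i)"
    and sym: "symmetric (e 1)" and det: "det (e 1 - g (e 1)) \<noteq> 0"
begin

lemma cyc2: "e (i + 2) = g (g (e i))"
  using cyc[of "i + 1"] cyc[of i] by (simp add: three_cycle)

lemma cyc_values: "e 2 = g (e 1)" "e 3 = g (g (e 1))"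
  using cyc[of 1] cyc2[of 1] by simp_all

lemma cyc_mem: "e i \<in> orbit_set g (e 1)"
  using exhaust_3[of i] cyc_values by (auto simp: orbit_set_def)

lemma range_cyc: "range e = orbit_set g (e 1)"
  by (simp add: UNIV_3 cyc_values orbit_set_def)

lemma cyc_distinct: "e i \<noteq> g (e i)"
proof
  assume "e i = g (e i)"
  then have "e 1 = g (e 1)"
    using exhaust_3[of i] cyc_values threefoldD(2)[OF g] by metis
  then show False using det by (simp add: det_zero)
qed

lemma inner_det_cyc: "inner_det g (e i) = inner_det g (e 1)"
  using exhaust_3[of i] cyc_values inner_det_invariant[OF g] by (metis ext)

lemma cyc_inj: "i \<noteq> j \<Longrightarrow> e i \<noteq> e j"
proof -
  assume ij: "i \<noteq> j"
  have "j = i + 1 \<or> i = j + 1"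
    using ij exhaust_3[of i] exhaust_3[of j] by auto
  then show "e i \<noteq> e j" using cyc_distinct cyc by metis
qed

lemma cyc_trace: "trace (e i) = trace (e 1)"
  using exhaust_3[of i] cyc_values strain_symmetryD(3)[OF threefoldD(1)[OF g]] by auto

lemma cyc_symmetric: "symmetric (e i)"
  using symmetric_orbit[OF g sym cyc_mem] .

text \<open>The parameters of a cyclic triple are chosen independently of each other among the roots of one cubic,
so uniqueness of the root makes them equal.\<close>

lemma T3_with_cyclic:
  "T3_with e l \<longleftrightarrow> (\<forall>i. 0 < l i \<and> l i < 1 \<and> inner_det g (e 1) (l i) = 0)"
proof -
  have incompatible: "\<not> compatible (e i) (e j)" if "i \<noteq> j" for i j
    using det_orbit_differences[OF g cyc_mem cyc_mem cyc_inj[OF that] det]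
      compatible_iff_det[OF cyc_symmetric cyc_symmetric] cyc_trace by metis
  have inner: "compatible (T3_inner_pt e l i) (e i) \<longleftrightarrow> inner_det g (e 1) (l i) = 0" for i
  proof -
    have "symmetric (T3_inner_pt e l i)"
      using cyc_symmetric[of "i + 1"] cyc_symmetric[of "i + 2"]
      by (simp add: T3_inner_pt_def vec_eq_iff transpose_def)
    moreover have "trace (T3_inner_pt e l i) = trace (e i)"
      unfolding T3_inner_pt_def linear_add[OF linear_trace] linear_cmul[OF linear_trace]
        cyc_trace[of "i + 1"] cyc_trace[of "i + 2"] cyc_trace[of i]
      by (simp add: algebra_simps)
    ultimately have "compatible (T3_inner_pt e l i) (e i) \<longleftrightarrow> det (T3_inner_pt e l i - e i) = 0"
      using compatible_iff_det cyc_symmetric by blast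
    also have "T3_inner_pt e l i - e i
      = l i *\<^sub>R e (i + 1) + (1 - l i) *\<^sub>R g (e (i + 1)) - g (g (e (i + 1)))"
      by (simp add: T3_inner_pt_def cyc cyc2 threefoldD[OF g])
    finally show ?thesis
      unfolding inner_det_def[symmetric] inner_det_cyc[of "i + 1"] .
  qed
  show ?thesis
    unfolding T3_with_def inner using cyc_symmetric cyc_trace incompatible by metis
qed

lemma is_symmetric_T3_cyclic: "is_symmetric_T3 e"
proof -
  obtain l where "0 < l" "l < 1" "inner_det g (e 1) l = 0"
    using inner_det_root_exists[OF g det] .
  then have "T3_with e (\<lambda>_. l)" by (simp add: T3_with_cyclic)
  then show ?thesis unfolding is_symmetric_T3_def by blast
qed

context
  fixes l assumes l: "0 < l" "l < 1" "inner_det g (e 1) l = 0"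
begin

lemma T3_inner_cyclic: "T3_inner e i = l *\<^sub>R e (i + 1) + (1 - l) *\<^sub>R e (i + 2)"
proof -
  have "(THE l. T3_with e l) = (\<lambda>_. l)"
  proof (rule the_equality)
    show "T3_with e (\<lambda>_. l)" using l by (simp add: T3_with_cyclic)
    show "k = (\<lambda>_. l)" if "T3_with e k" for k
      using that inner_det_root_unique[OF g det _ _ _ l] by (auto simp: T3_with_cyclic)
  qed
  then show ?thesis by (simp add: T3_inner_def T3_inner_pt_def)
qed

text \<open>The vertices are affinely independent, so the point of intersection can be found by comparing
coefficients.\<close>

lemma T3_node_cyclic: "T3_node e i = node g l (e (i + 1))"
proof -
  define a where "a = e (i + 1)"
  have ga: "e (i + 2) = g a" "e i = g (g a)"
    using cyc[of "i + 1"] cyc2[of "i + 1"] by (simp_all add: a_def three_cycle)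
  have inner: "T3_inner e (i + 1) = l *\<^sub>R g a + (1 - l) *\<^sub>R g (g a)"
    "T3_inner e (i + 2) = l *\<^sub>R g (g a) + (1 - l) *\<^sub>R a"
    using ga threefoldD(2)[OF g] cyc cyc2 a_def unfolding T3_inner_cyclic by metis+
  define D where "D = 1 - l + l^2"
  have D: "D > 0" unfolding D_def by (rule node_denominator_pos)
  let ?S = "closed_segment a (l *\<^sub>R g a + (1 - l) *\<^sub>R g (g a))"
  let ?T = "closed_segment (g a) (l *\<^sub>R g (g a) + (1 - l) *\<^sub>R a)"
  have node: "node g l a = ((1 - l)^2 / D) *\<^sub>R a + (l^2 / D) *\<^sub>R g a + (l * (1 - l) / D) *\<^sub>R g (g a)"
    by (simp add: node_def D_def scaleR_add_right)
  have "?S \<inter> ?T = {node g l a}"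
  proof (intro equalityI subsetI)
    fix x assume "x \<in> {node g l a}"
    then have x: "x = node g l a" by simp
    have "x = (1 - l / D) *\<^sub>R a + (l / D) *\<^sub>R (l *\<^sub>R g a + (1 - l) *\<^sub>R g (g a))"
    proof -
      have "(1 - l)^2 / D = 1 - l / D" "l^2 / D = l / D * l" "l * (1 - l) / D = l / D * (1 - l)"
        using D by (simp_all add: field_simps D_def power2_eq_square)
      then show ?thesis unfolding x node by (simp add: scaleR_add_right)
    qed
    moreover have "0 \<le> l / D" "l / D \<le> 1"
      using l D by (auto simp: D_def field_simps) (use zero_le_power2[of "1 - l"] in \<open>simp add: power2_eq_square algebra_simps\<close>)
    ultimately have 1: "x \<in> ?S" unfolding in_segment by blast
    have "x = (1 - (1 - l) / D) *\<^sub>R g a + ((1 - l) / D) *\<^sub>R (l *\<^sub>R g (g a) + (1 - l) *\<^sub>R a)"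
    proof -
      have "(1 - l)^2 / D = (1 - l) / D * (1 - l)" "l^2 / D = 1 - (1 - l) / D" "l * (1 - l) / D = (1 - l) / D * l"
        using D by (simp_all add: field_simps D_def power2_eq_square)
      then show ?thesis unfolding x node by (simp only:) (simp add: scaleR_add_right add_ac)
    qed
    moreover have "0 \<le> (1 - l) / D" "(1 - l) / D \<le> 1"
      using l D by (auto simp: D_def field_simps)
    ultimately have 2: "x \<in> ?T" unfolding in_segment by blast
    show "x \<in> ?S \<inter> ?T" using 1 2 by blast
  next
    fix x assume "x \<in> ?S \<inter> ?T"
    then have "x \<in> ?S" "x \<in> ?T" by blast+
    then obtain s t where s: "x = (1 - s) *\<^sub>R a + s *\<^sub>R (l *\<^sub>R g a + (1 - l) *\<^sub>R g (g a))"
      and t: "x = (1 - t) *\<^sub>R g a + t *\<^sub>R (l *\<^sub>R g (g a) + (1 - l) *\<^sub>R a)"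
      unfolding in_segment(1) by metis
    have "(1 - s - t * (1 - l)) *\<^sub>R a + (s * l - (1 - t)) *\<^sub>R g a + (s * (1 - l) - t * l) *\<^sub>R g (g a)
      = ((1 - s) *\<^sub>R a + s *\<^sub>R (l *\<^sub>R g a + (1 - l) *\<^sub>R g (g a)))
        - ((1 - t) *\<^sub>R g a + t *\<^sub>R (l *\<^sub>R g (g a) + (1 - l) *\<^sub>R a))"
      by (simp add: vec_eq_iff algebra_simps)
    also have "\<dots> = 0" unfolding s[symmetric] t[symmetric] by simp
    finally have *: "(1 - s - t * (1 - l)) *\<^sub>R a + (s * l - (1 - t)) *\<^sub>R g a + (s * (1 - l) - t * l) *\<^sub>R g (g a) = 0" .
    have "a \<noteq> g a" unfolding a_def by (rule cyc_distinct)
    from orbit_independent[OF g * _ this]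
    have "s * l = 1 - t" "s * (1 - l) = t * l" by (auto simp: algebra_simps)
    then have "s * D = l" unfolding D_def by algebra
    then have sD: "s = l / D" using D by (simp add: field_simps)
    have "1 - s = (1 - l)^2 / D" "s * l = l^2 / D" "s * (1 - l) = l * (1 - l) / D"
      using D unfolding sD by (simp_all add: field_simps D_def power2_eq_square)
    then show "x \<in> {node g l a}" unfolding s node by (simp add: scaleR_add_right)
  qed
  then show ?thesis
    unfolding T3_node_def inner ga using a_def[symmetric] by simp
qed

lemma range_T3_node_cyclic: "range (T3_node e) = node g l ` orbit_set g (e 1)"
proof -
  have "range (T3_node e) = node g l ` (e ` range (\<lambda>i. i + 1))"
    unfolding image_image T3_node_cyclic ..
  also have "range (\<lambda>i::3. i + 1) = UNIV" by (metis surjI diff_add_cancel)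
  finally show ?thesis by (simp add: range_cyc)
qed

end
end

text \<open>A bijective labelling of an orbit runs through it either forwards or backwards; both give
  the same nodes.\<close>

lemma range_T3_node:
  assumes g: "threefold g" and e: "range e = orbit_set g p" and sym: "symmetric p"
    and det: "det (p - g p) \<noteq> 0" and l: "0 < l" "l < 1" "inner_det g p l = 0"
  shows "range (T3_node e) = node g l ` orbit_set g p"
proof -
  let ?g = "\<lambda>X. g (g X)"
  have four: "e 4 = e 1" by (rule arg_cong[of _ _ e]) simp
  have ne: "p \<noteq> g p" using det by (auto simp: det_zero)
  then have ne': "g p \<noteq> g (g p)" "g (g p) \<noteq> p" using threefoldD(2)[OF g] by metis+
  have "card (range e) = 3" unfolding e orbit_set_def using ne ne' by auto
  then have "inj e" by (intro eq_card_imp_inj_on) simp_all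
  then have dist: "e 1 \<noteq> e 2" "e 2 \<noteq> e 3" "e 1 \<noteq> e 3" by (auto dest: injD)
  have mem: "e i \<in> orbit_set g p" for i using e by blast
  have orb: "orbit_set g (e 1) = orbit_set g p"
    using mem[of 1] by (auto simp: orbit_set_def threefoldD(2)[OF g])
  have sym1: "symmetric (e i)" for i using symmetric_orbit[OF g sym mem] .
  have det1: "det (x - y) \<noteq> 0" if "x \<in> orbit_set g p" "y \<in> orbit_set g p" "x \<noteq> y" for x y
    using det_orbit_differences[OF g that det] .
  have inner_det1: "inner_det g (e 1) l = 0"
    using mem[of 1] l inner_det_invariant[OF g] by (auto simp: orbit_set_def)
  have gne: "g (e 1) \<noteq> e 1" "g (g (e 1)) \<noteq> e 1"
    using mem[of 1] ne ne' threefoldD(2)[OF g] unfolding orbit_set_def by (metis insertE singletonD)+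
  have "e 2 \<in> orbit_set g (e 1)" "e 3 \<in> orbit_set g (e 1)" using mem orb by auto
  then consider "e 2 = g (e 1)" "e 3 = g (g (e 1))" | "e 2 = g (g (e 1))" "e 3 = g (e 1)"
    using dist by (auto simp: orbit_set_def)
  then show ?thesis
  proof cases
    case 1
    have "e (i + 1) = g (e i)" for i
      using exhaust_3[of i] 1 threefoldD(2)[OF g] four by auto
    from range_T3_node_cyclic[OF g this sym1 _ l(1,2) inner_det1]
    show ?thesis using det1[of "e 1" "g (e 1)"] mem gne orbit_set_closed[OF g] orb by metis
  next
    case 2
    have cyc: "e (i + 1) = g (g (e i))" for i
      using exhaust_3[of i] 2 threefoldD(2)[OF g] four by auto
    have d: "det (e 1 - g (g (e 1))) \<noteq> 0"
      using det1[of "e 1" "g (g (e 1))"] mem gne orbit_set_closed[OF g] by metis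
    have "range (T3_node e) = node ?g (1 - l) ` orbit_set ?g (e 1)"
      by (rule range_T3_node_cyclic[OF threefold_inverse[OF g] cyc sym1 d])
        (use l inner_det1 inner_det_inverse[OF g] in auto)
    also have "\<dots> = node g l ` orbit_set g p"
      unfolding node_inverse[OF g] orbit_set_inverse[OF g] orb
      by (auto simp: orbit_set_def threefoldD(2)[OF g] image_iff)
    finally show ?thesis .
  qed
qed

section \<open>Discs in the hull\<close>

lemma compatible_commute: "compatible x y \<Longrightarrow> compatible y x"
  by (erule compatible_scaleR[where c="-1"]) simp

lemma compatible_refl: "compatible x x"
proof -
  have "x - x = (1/2) *\<^sub>R (tensor 0 0 + tensor 0 0)" by (simp add: vec_eq_iff)
  then show ?thesis unfolding compatible_def by blast
qed

definition barycentre :: "(real^3^3 \<Rightarrow> real^3^3) \<Rightarrow> real^3^3 \<Rightarrow> real^3^3" where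
  "barycentre g p = (1/3) *\<^sub>R (p + g p + g (g p))"

context
  fixes g assumes g: "threefold g"
begin

interpretation L: linear g using g by (simp add: threefold_def strain_symmetry_def)

lemma nodes_compatible:
  assumes p: "symmetric p" and l: "0 < l" "l < 1" "inner_det g p l = 0"
    and xy: "x \<in> node g l ` orbit_set g p" "y \<in> node g l ` orbit_set g p"
  shows "compatible x y"
proof -
  have next1: "compatible (node g l z) (node g l (g z))" if z: "z \<in> orbit_set g p" for z
  proof -
    have "inner_det g z l = 0" using z l(3) inner_det_invariant[OF g] by (auto simp: orbit_set_def)
    then have "compatible (node g l z) (g z)"
      using compatible_node[OF g] symmetric_orbit[OF g p z] by blast
    moreover have "node g l z - node g l (g z) = (1 - l / (1 - l)) *\<^sub>R (node g l z - g z)"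
      unfolding node_equivariant[OF g, symmetric] node_step[OF g l(1,2)]
      by (simp add: vec_eq_iff) (simp add: algebra_simps)
    ultimately show ?thesis by (rule compatible_scaleR)
  qed
  obtain v w where vw: "v \<in> orbit_set g p" "w \<in> orbit_set g p" "x = node g l v" "y = node g l w"
    using xy by blast
  then consider "v = w" | "w = g v" | "v = g w"
    using threefoldD(2)[OF g] by (auto simp: orbit_set_def)
  then show ?thesis
    using vw next1 compatible_commute compatible_refl by cases auto
qed

lemma node_triangle_in_hull:
  assumes p: "symmetric p" and l: "0 < l" "l < 1" "l \<noteq> 1/2" "inner_det g p l = 0"
  shows "convex hull (node g l ` orbit_set g p) \<subseteq> rank_one_hull (orbit_set g p)"
proof (rule convex_hull_subset_lamination_convex)
  show "finite (node g l ` orbit_set g p)" by (simp add: orbit_set_def)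
  show "lamination_convex (rank_one_hull (orbit_set g p))" by (rule lamination_convex_rank_one_hull)
  show "node g l ` orbit_set g p \<subseteq> rank_one_hull (orbit_set g p)"
    using node_in_hull[OF g p l] by blast
qed (use nodes_compatible[OF p l(1,2,4)] in blast)

text \<open>In affine coordinates that place the vertices at the cube roots of unity, the nodes form an
equilateral triangle about the origin of circumradius at least \<open>\<bar>1 - 2 l\<bar>\<close>, so it contains a disc.\<close>

lemma scaled_vertex_in_node_triangle:
  assumes l: "0 < l" "l < 1" "l \<noteq> 1/2" and t: "\<bar>t\<bar> \<le> (1 - 2 * l)^2 / 3"
  shows "barycentre g p + t *\<^sub>R (p - barycentre g p) \<in> convex hull (node g l ` orbit_set g p)"
proof -
  define m where "m = 1 - l"
  define D where "D = 1 - l + l^2"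
  define W where "W = (1 - 2 * l)^2"
  have D: "D > 0" unfolding D_def by (rule node_denominator_pos)
  have W: "W > 0" using l(3) by (simp add: W_def)
  define r where "r = t / W"
  have tr: "t = r * W" using W by (simp add: r_def)
  have r: "\<bar>r\<bar> \<le> 1 / 3" using t[folded W_def] W by (simp add: r_def field_simps)
  \<comment> \<open>the barycentric coordinates of the point with respect to the nodes, obtained by
inverting a circulant matrix\<close>
  define A B C where ABC: "A = 1/3 + r/3 * (3 * m^2 - D)" "B = 1/3 + r/3 * (3 * (l * m) - D)"
    "C = 1/3 + r/3 * (3 * l^2 - D)"
  have nonneg: "0 \<le> 1/3 + r/3 * (3 * z - D)" if "0 \<le> z" "z \<le> 1" for z
  proof -
    have "D \<le> 1" using mult_left_le[of l l] l by (simp add: D_def power2_eq_square)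
    then have "\<bar>3 * z - D\<bar> \<le> 3" using that D by auto
    then have "\<bar>r\<bar> * \<bar>3 * z - D\<bar> \<le> 1/3 * 3" using r by (intro mult_mono) auto
    then have "\<bar>r * (3 * z - D)\<bar> \<le> 1" by (simp add: abs_mult)
    then show ?thesis by (simp add: abs_le_iff)
  qed
  have lm: "0 \<le> m" "m \<le> 1" "0 \<le> l" "l \<le> 1" using l by (auto simp: m_def)
  then have ge0: "A \<ge> 0" "B \<ge> 0" "C \<ge> 0"
    unfolding ABC by (intro nonneg; simp add: power_le_one mult_le_one)+
  have D': "D = m^2 + l * m + l^2" and W': "W = (m - l)^2" and ml: "m + l = 1"
    by (simp_all add: D_def W_def m_def power2_eq_square algebra_simps)
  have sum1: "A + B + C = 1" unfolding ABC D' by (simp add: field_simps)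
  have coeff: "A * m^2 + B * (l * m) + C * l^2 = D * ((1 + 2 * t) / 3)"
    "A * l^2 + B * m^2 + C * (l * m) = D * ((1 - t) / 3)"
    "A * (l * m) + B * l^2 + C * m^2 = D * ((1 - t) / 3)"
    unfolding ABC tr D' W' by (simp_all add: field_simps power2_eq_square)
  have "D *\<^sub>R (A *\<^sub>R node g l p + B *\<^sub>R node g l (g p) + C *\<^sub>R node g l (g (g p)))
      = A *\<^sub>R (m^2 *\<^sub>R p + l^2 *\<^sub>R g p + (l * m) *\<^sub>R g (g p))
      + B *\<^sub>R (m^2 *\<^sub>R g p + l^2 *\<^sub>R g (g p) + (l * m) *\<^sub>R p)
      + C *\<^sub>R (m^2 *\<^sub>R g (g p) + l^2 *\<^sub>R p + (l * m) *\<^sub>R g p)"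
  proof -
    have "D *\<^sub>R node g l x = m^2 *\<^sub>R x + l^2 *\<^sub>R g x + (l * m) *\<^sub>R g (g x)" for x
      using D by (simp add: node_def D_def m_def)
    note n = this[of p] this[of "g p"] this[of "g (g p)"]
    have "D *\<^sub>R (A *\<^sub>R x + B *\<^sub>R y + C *\<^sub>R z)
        = A *\<^sub>R (D *\<^sub>R x) + B *\<^sub>R (D *\<^sub>R y) + C *\<^sub>R (D *\<^sub>R z)" for x y z :: "real^3^3"
      by (simp add: scaleR_add_right mult.commute)
    then show ?thesis unfolding n threefoldD(2)[OF g] by (simp only: n threefoldD(2)[OF g])
  qed
  also have "\<dots> = (A * m^2 + B * (l * m) + C * l^2) *\<^sub>R p
      + (A * l^2 + B * m^2 + C * (l * m)) *\<^sub>R g p + (A * (l * m) + B * l^2 + C * m^2) *\<^sub>R g (g p)"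
    by (simp add: vec_eq_iff) (simp add: algebra_simps)
  also have "\<dots> = D *\<^sub>R (barycentre g p + t *\<^sub>R (p - barycentre g p))"
    unfolding coeff barycentre_def by (simp add: vec_eq_iff) (simp add: field_simps)
  finally have eq: "barycentre g p + t *\<^sub>R (p - barycentre g p)
      = A *\<^sub>R node g l p + B *\<^sub>R node g l (g p) + C *\<^sub>R node g l (g (g p))"
    using D by simp
  show ?thesis
    unfolding eq orbit_set_def image_insert image_empty convex_hull_3 using ge0 sum1 by blast
qed

lemma scaled_vertex_in_hull:
  assumes p: "symmetric p" and det: "det (p - g p) \<noteq> 0" and h: "inner_det g p (1/2) \<noteq> 0"
    and t: "\<bar>t\<bar> \<le> (inner_det g p (1/2) / (2 * \<bar>det (p - g p)\<bar> + \<bar>inner_det g p (1/2)\<bar>))^2 / 3"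
  shows "barycentre g p + t *\<^sub>R (p - barycentre g p) \<in> rank_one_hull (orbit_set g p)"
proof -
  let ?h = "inner_det g p (1/2)" and ?b = "2 * \<bar>det (p - g p)\<bar> + \<bar>inner_det g p (1/2)\<bar>"
  obtain l where l: "0 < l" "l < 1" "inner_det g p l = 0"
    using inner_det_root_exists[OF g det] .
  have half: "l \<noteq> 1/2" using l(3) h by metis
  have b: "?b > 0" using h by (simp add: add_nonneg_pos)
  have "\<bar>?h\<bar> / ?b \<le> \<bar>1 - 2 * l\<bar>"
    using inner_det_root_away_from_half[OF g det l] b by (simp add: divide_le_eq)
  then have "(\<bar>?h\<bar> / ?b)^2 \<le> \<bar>1 - 2 * l\<bar>^2"
    by (intro power_mono) (use b in auto)
  then have "(?h / ?b)^2 \<le> (1 - 2 * l)^2" by (simp add: power_divide)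
  with t have "\<bar>t\<bar> \<le> (1 - 2 * l)^2 / 3" by linarith
  from scaled_vertex_in_node_triangle[OF l(1,2) half this] node_triangle_in_hull[OF p l(1,2) half l(3)]
  show ?thesis by blast
qed

end

section \<open>Dual triples\<close>

context
  fixes g q
  assumes g: "threefold g" and q: "strain_symmetry q" "\<And>X. q (q X) = X"
    and qg: "\<And>X. q (g (q X)) = g (g X)"
begin

interpretation L: linear g using g by (simp add: threefold_def strain_symmetry_def)
interpretation Q: linear q using q by (simp add: strain_symmetry_def)

lemma q_swap: "q (g X) = g (g (q X))"
  using qg[of "q X"] by (simp add: q(2))

lemma orbit_set_dual: "orbit_set g (q p) = q ` orbit_set g p"
  by (auto simp: orbit_set_def q_swap threefoldD(2)[OF g])

lemma node_dual: "node g (1 - l) (q x) = q (node g l (g (g x)))"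
proof -
  have "1 - (1 - l) + (1 - l)^2 = 1 - l + l^2" by (simp add: power2_eq_square algebra_simps)
  then show ?thesis
    unfolding node_def by (simp add: Q.add Q.scale q_swap threefoldD(2)[OF g] add_ac mult.commute)
qed

lemma node_image_dual:
  "node g (1 - l) ` orbit_set g (q p) = q ` node g l ` orbit_set g p"
  unfolding orbit_set_dual image_image node_dual
  by (auto simp: orbit_set_def threefoldD(2)[OF g])

lemma inner_det_dual: "inner_det g (q p) (1 - l) = inner_det g p l"
proof -
  have "q (l *\<^sub>R p + (1 - l) *\<^sub>R g p - g (g p))
      = l *\<^sub>R q p + (1 - l) *\<^sub>R g (g (q p)) - g (g (g (g (q p))))"
    by (simp add: Q.add Q.diff Q.scale q_swap)
  then have "inner_det (\<lambda>X. g (g X)) (q p) l = inner_det g p l"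
    unfolding inner_det_def using strain_symmetryD(2)[OF q(1)] by metis
  then show ?thesis using inner_det_inverse[OF g, of "q p" "1 - l"] by simp
qed

lemma det_dual: "det (q p - g (q p)) = - det (p - g p)"
proof -
  have "g (q (p - g p)) = - (q p - g (q p))"
    by (simp add: Q.diff L.diff q_swap threefoldD(2)[OF g])
  moreover have "det (g (q (p - g p))) = det (p - g p)"
    by (simp only: strain_symmetryD(2)[OF q(1)] strain_symmetryD(2)[OF threefoldD(1)[OF g]])
  ultimately show ?thesis by (simp only: det_minus)
qed

text \<open>The two points are exchanged by an involution \<open>k\<close>, one of \<open>q\<close>, \<open>q g\<close> and \<open>q g\<^sup>2\<close>. So \<open>k\<close> maps their
difference to its negative, while it preserves determinants.\<close>

lemma compatible_dual:
  assumes "symmetric x" "z \<in> orbit_set g x"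
  shows "compatible x (q z)"
proof -
  have inv: "compatible x (k x)" if k: "strain_symmetry k" "k (k x) = x" for k
  proof (subst compatible_iff_det)
    have "k (x - k x) = - (x - k x)"
      using strain_symmetry_linear_simps[OF k(1)] k(2) by simp
    then have "det (x - k x) = - det (x - k x)"
      using strain_symmetryD(2)[OF k(1)] det_minus by metis
    then show "det (x - k x) = 0" by simp
  qed (use assms(1) strain_symmetryD[OF k(1)] in auto)
  have 1: "strain_symmetry (\<lambda>X. q (g X))" "strain_symmetry (\<lambda>X. q (g (g X)))"
    using strain_symmetry_comp q(1) threefoldD(1)[OF g]
      threefoldD(1)[OF threefold_inverse[OF g]] by blast+
  have 2: "q (g (q (g x))) = x" "q (g (g (q (g (g x))))) = x"
    by (simp_all add: q_swap q(2) threefoldD(2)[OF g])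
  from assms(2) consider "z = x" | "z = g x" | "z = g (g x)" by (auto simp: orbit_set_def)
  then show ?thesis
    using inv[OF q(1) q(2)] inv[OF 1(1) 2(1)] inv[OF 1(2) 2(2)] by cases auto
qed

lemma six_nodes_compatible:
  assumes p: "symmetric p" and l: "0 < l" "l < 1" "inner_det g p l = 0"
    and N: "N = node g l ` orbit_set g p" and xy: "x \<in> N \<union> q ` N" "y \<in> N \<union> q ` N"
  shows "compatible x y"
proof -
  have sym: "symmetric x" if x: "x \<in> N" for x
  proof -
    obtain v where v: "v \<in> orbit_set g p" "x = node g l v" using x N by blast
    then show ?thesis
      using symmetric_orbit[OF g p v(1)] symmetric_orbit[OF g p orbit_set_closed[OF g v(1)]]
        symmetric_orbit[OF g p orbit_set_closed[OF g orbit_set_closed[OF g v(1)]]]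
      by (simp add: node_def vec_eq_iff transpose_def)
  qed
  have NN: "compatible x y" if "x \<in> N" "y \<in> N" for x y
    using nodes_compatible[OF g p l] that N by blast
  have orb: "y \<in> orbit_set g x" if "x \<in> N" "y \<in> N" for x y
    using that unfolding N orbit_set_def
    by (auto simp: node_equivariant[OF g] threefoldD(2)[OF g])
  have NQ: "compatible x (q y)" if "x \<in> N" "y \<in> N" for x y
    using compatible_dual sym orb that by blast
  have QQ: "compatible (q x) (q y)" if "x \<in> N" "y \<in> N" for x y
  proof (subst compatible_iff_det)
    have "det (x - y) = 0" using NN[OF that] sym[OF that(1)] sym[OF that(2)] 
      using compatible_iff_det NQ det_symmetric_part_tensor unfolding compatible_def by metis
    then show "det (q x - q y) = 0"
      using strain_symmetryD(2)[OF q(1), of "x - y"] by (simp add: Q.diff)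
    have "trace x = trace y"
      using orb[OF that] strain_symmetryD(3)[OF threefoldD(1)[OF g]] by (auto simp: orbit_set_def)
    then show "trace (q x) = trace (q y)" using strain_symmetryD(3)[OF q(1)] by simp
  qed (use strain_symmetry_symmetric[OF q(1)] sym that in auto)
  show ?thesis using xy NN NQ QQ compatible_commute by blast
qed

end

section \<open>Polynomial conditions\<close>

lemma real_polynomial_function_linear:
  fixes f :: "'a::euclidean_space \<Rightarrow> real"
  shows "linear f \<Longrightarrow> real_polynomial_function f"
  by (simp add: linear_conv_bounded_linear real_polynomial_function.intros(1))

lemma real_polynomial_function_det:
  assumes "linear (A :: real^3^3 \<Rightarrow> real^3^3)"
  shows "real_polynomial_function (\<lambda>p. det (A p))"
proof -
  have "real_polynomial_function (\<lambda>p. A p $ i $ j)" for i j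
  proof (rule real_polynomial_function_linear, rule linearI)
    show "A (x + y) $ i $ j = A x $ i $ j + A y $ i $ j" for x y
      using assms by (simp add: linear_add)
    show "A (c *\<^sub>R x) $ i $ j = c *\<^sub>R A x $ i $ j" for c x
      using assms by (simp add: linear_cmul)
  qed
  then show ?thesis
    unfolding det_3
    by (intro real_polynomial_function.intros(3,4) real_polynomial_function_diff)
qed

text \<open>On the line from a relatively interior point to \<open>b\<close> the polynomial is not identically zero, so
it has finitely many zeros there.\<close>

lemma nonzero_in_rel_interior:
  fixes C :: "'a::euclidean_space set"
  assumes C: "convex C" and G: "real_polynomial_function G"
    and b: "b \<in> affine hull C" "G b \<noteq> 0"
  obtains p where "p \<in> rel_interior C" "G p \<noteq> 0"
proof -
  have "C \<noteq> {}" using b(1) by auto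
  then obtain c where c: "c \<in> rel_interior C" using rel_interior_eq_empty[OF C] by blast
  define x where "x s = c + s *\<^sub>R (b - c)" for s :: real
  have c': "c \<in> affine hull C" using c rel_interior_subset hull_subset[of C affine] by blast
  then have x_hull: "x s \<in> affine hull C" for s
    using mem_affine[OF affine_affine_hull c' b(1), of "1 - s" s]
    by (simp add: x_def algebra_simps)
  have contx: "isCont x 0" unfolding x_def by (intro continuous_intros)
  obtain T where T: "open T" "rel_interior C = T \<inter> affine hull C"
    using openin_rel_interior[of C] unfolding openin_open by (metis Int_commute)
  have "(x \<longlongrightarrow> x 0) (nhds 0)"
    using contx by (simp only: isCont_def tendsto_at_iff_tendsto_nhds)
  moreover have "x 0 \<in> T" using c T(2) by (simp add: x_def)
  ultimately have "eventually (\<lambda>s. x s \<in> T) (nhds 0)" using T(1) topological_tendstoD by blast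
  then obtain e where e: "e > 0" "\<And>s. \<bar>s\<bar> < e \<Longrightarrow> x s \<in> T"
    unfolding eventually_nhds_metric by (auto simp: dist_real_def)
  have "polynomial_function x"
    unfolding x_def
    by (intro polynomial_function_add polynomial_function_const polynomial_function_mult)
       (auto intro!: polynomial_function_bounded_linear bounded_linear_ident)
  then have "real_polynomial_function (G \<circ> x)" using G by (rule real_polynomial_function_compose)
  then obtain a n where a: "G \<circ> x = (\<lambda>s. \<Sum>i\<le>n. a i * s^i)"
    unfolding real_polynomial_function_iff_sum by blast
  have "\<exists>i\<le>n. a i \<noteq> 0"
  proof (rule ccontr)
    assume "\<not> ?thesis"
    then have "(G \<circ> x) 1 = 0" unfolding a by simp
    then show False using b(2) by (simp add: x_def)
  qed
  then have "finite {s. (G \<circ> x) s = 0}"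
    unfolding a using polyfun_finite_roots[where c = a] by blast
  moreover have "infinite {0<..<e}" using e(1) by simp
  ultimately obtain s where s: "s \<in> {0<..<e}" "(G \<circ> x) s \<noteq> 0"
    by (metis (mono_tags, lifting) finite_subset mem_Collect_eq subsetI)
  show thesis
    by (rule that[of "x s"]) (use s e(2)[of s] x_hull T(2) in auto)
qed

section \<open>Mixtures\<close>

lemma mixture_image_weights:
  "mixture n n' ` weights = convex hull (range n \<union> range n')"
proof
  show "mixture n n' ` weights \<subseteq> convex hull (range n \<union> range n')"
  proof clarify
    fix u u' assume w: "(u, u') \<in> weights"
    let ?f = "\<lambda>x. case x of Inl i \<Rightarrow> n i | Inr i \<Rightarrow> n' i"
    let ?w = "\<lambda>x. case x of Inl i \<Rightarrow> u i | Inr i \<Rightarrow> u' i"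
    have split: "sum h UNIV = (\<Sum>i\<in>UNIV. h (Inl i)) + (\<Sum>i\<in>UNIV. h (Inr i))"
      for h :: "3 + 3 \<Rightarrow> 'b::ab_group_add"
      unfolding UNIV_sum by (subst sum.union_disjoint) (auto simp: sum.reindex)
    have "(\<Sum>x\<in>UNIV. ?w x *\<^sub>R ?f x) \<in> convex hull (range n \<union> range n')"
    proof (rule convex_sum)
      show "sum ?w UNIV = 1" using w by (simp add: split weights_def)
      show "?w x \<ge> 0" for x using w by (cases x) (auto simp: weights_def)
      show "?f x \<in> convex hull (range n \<union> range n')" for x
        by (rule hull_inc) (cases x; auto)
    qed (simp_all add: finite_UNIV convex_convex_hull)
    then show "mixture n n' (u, u') \<in> convex hull (range n \<union> range n')"
      by (simp add: split mixture_def)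
  qed
  show "convex hull (range n \<union> range n') \<subseteq> mixture n n' ` weights"
  proof (rule hull_minimal)
    have 1: "n i \<in> mixture n n' ` weights" for i
    proof (rule image_eqI)
      show "(\<lambda>j. if j = i then 1 else 0, \<lambda>j. 0) \<in> weights" by (auto simp: weights_def)
      show "n i = mixture n n' (\<lambda>j. if j = i then 1 else 0, \<lambda>j. 0)"
        by (simp add: mixture_def if_distrib[of "\<lambda>c. c *\<^sub>R _"] cong: if_cong)
    qed
    have 2: "n' i \<in> mixture n n' ` weights" for i
    proof (rule image_eqI)
      show "(\<lambda>j. 0, \<lambda>j. if j = i then 1 else 0) \<in> weights" by (auto simp: weights_def)
      show "n' i = mixture n n' (\<lambda>j. 0, \<lambda>j. if j = i then 1 else 0)"
        by (simp add: mixture_def if_distrib[of "\<lambda>c. c *\<^sub>R _"] cong: if_cong)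
    qed
    show "range n \<union> range n' \<subseteq> mixture n n' ` weights" using 1 2 by blast
    show "convex (mixture n n' ` weights)"
    proof (rule convexI)
      fix x y and a b :: real
      assume xy: "x \<in> mixture n n' ` weights" "y \<in> mixture n n' ` weights"
        and ab: "0 \<le> a" "0 \<le> b" "a + b = 1"
      then obtain u u' v v' where w: "(u, u') \<in> weights" "(v, v') \<in> weights"
        and x: "x = mixture n n' (u, u')" and y: "y = mixture n n' (v, v')" by auto
      have unit: "a * s + b * t \<in> {0..1}" if "s \<in> {0..1}" "t \<in> {0..1}" for s t
        using that ab convex_bound_le[of s 1 t a b] by auto
      have "a * (sum u UNIV + sum u' UNIV) + b * (sum v UNIV + sum v' UNIV) = 1"
        using w ab by (simp add: weights_def)
      then have "(\<Sum>i\<in>UNIV. a * u i + b * v i) + (\<Sum>i\<in>UNIV. a * u' i + b * v' i) = 1"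
        by (simp add: sum.distrib sum_distrib_left[symmetric] algebra_simps)
      moreover have "a * u i + b * v i \<in> {0..1} \<and> a * u' i + b * v' i \<in> {0..1}" for i
        using w unfolding weights_def by (blast intro: unit)
      ultimately have "(\<lambda>i. a * u i + b * v i, \<lambda>i. a * u' i + b * v' i) \<in> weights"
        unfolding weights_def by blast
      moreover have "a *\<^sub>R x + b *\<^sub>R y = mixture n n' (\<lambda>i. a * u i + b * v i, \<lambda>i. a * u' i + b * v' i)"
        by (simp add: x y mixture_def scaleR_add_left scaleR_add_right sum.distrib scaleR_sum_right)
      ultimately show "a *\<^sub>R x + b *\<^sub>R y \<in> mixture n n' ` weights" by blast
    qed
  qed
qed

section \<open>Five-dimensional unions and boundary points\<close>

lemma isCont_eventually_nhds:
  "isCont f a \<Longrightarrow> open S \<Longrightarrow> f a \<in> S \<Longrightarrow> eventually (\<lambda>x. f x \<in> S) (nhds a)"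
  unfolding isCont_def tendsto_at_iff_tendsto_nhds by (rule topological_tendstoD)

context
  fixes r assumes r: "threefold r"
begin

interpretation L: linear r using r by (simp add: threefold_def strain_symmetry_def)

lemma linear_barycentre: "linear (barycentre r)"
  by (rule linearI) (simp_all add: barycentre_def L.add L.scale algebra_simps)

lemma barycentre_idem: "barycentre r (barycentre r p) = barycentre r p"
proof -
  have *: "r (barycentre r p) = barycentre r p"
    by (simp add: barycentre_def L.add L.scale threefoldD(2)[OF r] add_ac)
  show ?thesis
    unfolding barycentre_def[of r "barycentre r p"] * by (simp add: vec_eq_iff)
qed

lemma symmetric_barycentre: "symmetric p \<Longrightarrow> symmetric (barycentre r p)"
  using symmetric_orbit[OF r, of p "r p"] symmetric_orbit[OF r, of p "r (r p)"]
  by (simp add: barycentre_def orbit_set_def vec_eq_iff transpose_def)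

lemma trace_barycentre: "trace (barycentre r p) = trace p"
  unfolding barycentre_def linear_add[OF linear_trace] linear_cmul[OF linear_trace]
    strain_symmetryD(3)[OF threefoldD(1)[OF r]] by simp

lemma generic_point:
  fixes \<Lambda> :: "real^3^3 \<Rightarrow> real"
  assumes L: "linear \<Lambda>" and C: "convex C"
    and b: "b \<in> affine hull C" "det (b - r b) \<noteq> 0" "inner_det r b (1/2) \<noteq> 0" "\<Lambda> (barycentre r b) \<noteq> c"
  obtains p where "p \<in> rel_interior C" "det (p - r p) \<noteq> 0" "inner_det r p (1/2) \<noteq> 0"
    "\<Lambda> (barycentre r p) \<noteq> c"
proof -
  let ?G = "\<lambda>p. det (p - r p) * inner_det r p (1/2) * (\<Lambda> (barycentre r p) - c)"
  have 1: "real_polynomial_function (\<lambda>p. det (p - r p))"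
    by (rule real_polynomial_function_det, rule linearI) (simp_all add: L.add L.scale algebra_simps)
  have 2: "real_polynomial_function (\<lambda>p. inner_det r p (1/2))"
    unfolding inner_det_def
    by (rule real_polynomial_function_det, rule linearI) (simp_all add: L.add L.scale algebra_simps)
  have 3: "real_polynomial_function (\<lambda>p. \<Lambda> (barycentre r p))"
    using linear_compose[OF linear_barycentre L]
    by (intro real_polynomial_function_linear) (simp add: o_def)
  have "real_polynomial_function ?G"
    by (intro real_polynomial_function.intros(2,4) real_polynomial_function_diff 1 2 3)
  from nonzero_in_rel_interior[OF C this b(1)] b(2-4) obtain p where
    "p \<in> rel_interior C" "?G p \<noteq> 0" by auto
  then show thesis using that by auto
qed

lemma isCont_det_inner_det:
  "isCont (\<lambda>p. det (p - r p)) x" "isCont (\<lambda>p. inner_det r p (1/2)) x"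
proof -
  have 1: "real_polynomial_function (\<lambda>p. det (p - r p))"
    by (rule real_polynomial_function_det, rule linearI) (simp_all add: L.add L.scale algebra_simps)
  have 2: "real_polynomial_function (\<lambda>p. inner_det r p (1/2))"
    unfolding inner_det_def
    by (rule real_polynomial_function_det, rule linearI) (simp_all add: L.add L.scale algebra_simps)
  show "isCont (\<lambda>p. det (p - r p)) x" "isCont (\<lambda>p. inner_det r p (1/2)) x"
    using continuous_real_polymonial_function 1 2 by blast+
qed

text \<open>Near a suitable \<open>q0\<close> every \<open>q\<close> in the trace space is obtained by scaling a point of \<open>C\<close> towards
the barycentre of its orbit. The barycentre of \<open>q\<close> is that of the sought point \<open>p\<close>, and the scaling factor is
then forced by \<open>\<Lambda> p = c\<close>. So the inverse map is explicit and continuous.\<close>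

lemma five_dimensional_union:
  fixes \<Lambda> :: "real^3^3 \<Rightarrow> real"
  assumes L: "linear \<Lambda>"
    and hull: "affine hull C = {X. symmetric X \<and> trace X = t \<and> \<Lambda> X = c}"
    and p0: "p0 \<in> rel_interior C" "det (p0 - r p0) \<noteq> 0" "inner_det r p0 (1/2) \<noteq> 0"
      "\<Lambda> (barycentre r p0) \<noteq> c"
    and U: "\<And>p. p \<in> C \<Longrightarrow> det (p - r p) \<noteq> 0 \<Longrightarrow> rank_one_hull (orbit_set r p) \<subseteq> U"
  shows "(top_of_set (trace_space t)) interior_of U \<noteq> {}"
proof -
  let ?m = "barycentre r" and ?d = "\<lambda>p. det (p - r p)" and ?h = "\<lambda>p. inner_det r p (1/2)"
  \<comment> \<open>the length of scaling that \<open>scaled_vertex_in_hull\<close> permits\<close>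
  define B where "B p = (?h p / (2 * \<bar>?d p\<bar> + \<bar>?h p\<bar>))^2 / 3" for p
  have den: "2 * \<bar>?d p0\<bar> + \<bar>?h p0\<bar> \<noteq> 0" using p0(3) by simp
  have B0: "B p0 > 0" using p0(3) den by (simp add: B_def)
  have contB: "isCont B p0"
    unfolding B_def by (intro continuous_intros isCont_det_inner_det) (use den in auto)
  define t0 where "t0 = B p0 / 2"
  define q0 where "q0 = ?m p0 + t0 *\<^sub>R (p0 - ?m p0)"
  \<comment> \<open>\<open>\<tau> q\<close> is the scaling factor and \<open>\<pi> q\<close> the point that is scaled\<close>
  define \<tau> where "\<tau> q = \<Lambda> (q - ?m q) / (c - \<Lambda> (?m q))" for q
  define \<pi> where "\<pi> q = ?m q + (1 / \<tau> q) *\<^sub>R (q - ?m q)" for q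
  have C0: "p0 \<in> affine hull C"
    using p0(1) rel_interior_subset hull_subset[of C affine] by blast
  then have s0: "symmetric p0" "trace p0 = t" "\<Lambda> p0 = c" unfolding hull by auto
  have lin: "?m (x + y) = ?m x + ?m y" "?m (x - y) = ?m x - ?m y" "?m (k *\<^sub>R x) = k *\<^sub>R ?m x" for x y k
    using linear_barycentre by (simp_all add: linear_add linear_diff linear_cmul)
  have Lin: "\<Lambda> (x + y) = \<Lambda> x + \<Lambda> y" "\<Lambda> (x - y) = \<Lambda> x - \<Lambda> y" "\<Lambda> (k *\<^sub>R x) = k * \<Lambda> x" for x y k
    using L by (simp_all add: linear_add linear_diff linear_cmul)
  have t0: "t0 > 0" "t0 < B p0" using B0 by (auto simp: t0_def)
  have m0: "?m q0 = ?m p0" by (simp add: q0_def lin barycentre_idem)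
  have ne: "c - \<Lambda> (?m q0) \<noteq> 0" using p0(4) m0 by simp
  have \<tau>0: "\<tau> q0 = t0"
  proof -
    have "\<Lambda> (q0 - ?m q0) = t0 * (c - \<Lambda> (?m q0))"
      unfolding m0 by (simp add: q0_def Lin s0)
    then show ?thesis using ne by (simp add: \<tau>_def)
  qed
  have \<pi>0: "\<pi> q0 = p0"
    unfolding \<pi>_def \<tau>0 m0 using t0 by (simp add: q0_def)
  have cm: "isCont ?m x" for x
    using linear_barycentre by (simp add: linear_continuous_at linear_conv_bounded_linear)
  have cL: "isCont (\<lambda>x. \<Lambda> (f x)) x" if "isCont f x" for f x
    using isCont_o2[OF that, of \<Lambda>] L
    by (simp add: linear_continuous_at linear_conv_bounded_linear)
  have cm': "isCont (\<lambda>q. c - \<Lambda> (?m q)) q0" by (intro continuous_intros cL cm)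
  have c\<tau>: "isCont \<tau> q0"
    unfolding \<tau>_def by (intro continuous_intros cL cm ne)
  have c\<pi>: "isCont \<pi> q0"
    unfolding \<pi>_def by (intro continuous_intros cm c\<tau>) (use \<tau>0 t0 in auto)
  obtain T where T: "open T" "rel_interior C = T \<inter> affine hull C"
    using openin_rel_interior[of C] unfolding openin_open by (metis Int_commute)
  have e1: "\<forall>\<^sub>F q in nhds q0. c - \<Lambda> (?m q) \<in> - {0}"
    by (rule isCont_eventually_nhds[OF cm']) (use ne in auto)
  have e2: "\<forall>\<^sub>F q in nhds q0. \<tau> q \<in> {0<..}"
    by (rule isCont_eventually_nhds[OF c\<tau>]) (use \<tau>0 t0 in auto)
  have e3: "\<forall>\<^sub>F q in nhds q0. \<pi> q \<in> T"
    by (rule isCont_eventually_nhds[OF c\<pi>]) (use \<pi>0 T p0(1) in auto)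
  have e4: "\<forall>\<^sub>F q in nhds q0. ?d (\<pi> q) \<in> - {0}"
    by (rule isCont_eventually_nhds[OF isCont_o2[OF c\<pi>]])
       (use \<pi>0 p0 isCont_det_inner_det in auto)
  have e5: "\<forall>\<^sub>F q in nhds q0. ?h (\<pi> q) \<in> - {0}"
    by (rule isCont_eventually_nhds[OF isCont_o2[OF c\<pi>]])
       (use \<pi>0 p0 isCont_det_inner_det in auto)
  have e6: "\<forall>\<^sub>F q in nhds q0. B (\<pi> q) - \<tau> q \<in> {0<..}"
  proof (rule isCont_eventually_nhds)
    show "isCont (\<lambda>q. B (\<pi> q) - \<tau> q) q0"
      using isCont_o2[OF c\<pi>, of B] contB \<pi>0 c\<tau> by (intro continuous_intros) auto
  qed (use \<pi>0 \<tau>0 t0 in auto)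
  have "\<forall>\<^sub>F q in nhds q0. q \<in> trace_space t \<longrightarrow> q \<in> U"
    using e1 e2 e3 e4 e5 e6
  proof eventually_elim
    case (elim q)
    show ?case
    proof
      assume "q \<in> trace_space t"
      then have q: "symmetric q" "trace q = t" by (auto simp: trace_space_def)
      let ?p = "\<pi> q"
      have \<tau>: "\<tau> q > 0" "\<tau> q < B ?p" using elim by auto
      have mp: "?m ?p = ?m q" by (simp add: \<pi>_def lin barycentre_idem)
      have "symmetric ?p"
        using q symmetric_barycentre[OF q(1)] by (simp add: \<pi>_def vec_eq_iff transpose_def)
      moreover have "trace ?p = t"
        unfolding \<pi>_def linear_add[OF linear_trace] linear_cmul[OF linear_trace]
          linear_diff[OF linear_trace] trace_barycentre q(2) by simp
      moreover have "\<Lambda> ?p = c"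
      proof -
        have "\<Lambda> (q - ?m q) = \<tau> q * (c - \<Lambda> (?m q))" using elim by (simp add: \<tau>_def)
        then show ?thesis using \<tau> by (simp add: \<pi>_def Lin(1,3))
      qed
      ultimately have p: "symmetric ?p" "?p \<in> affine hull C" unfolding hull by auto
      then have "?p \<in> C" using elim T(2) rel_interior_subset by blast
      then have sub: "rank_one_hull (orbit_set r ?p) \<subseteq> U" using U elim by simp
      have "?m ?p + \<tau> q *\<^sub>R (?p - ?m ?p) \<in> rank_one_hull (orbit_set r ?p)"
        by (rule scaled_vertex_in_hull[OF r p(1)]) (use elim \<tau> in \<open>auto simp: B_def\<close>)
      moreover have "?m ?p + \<tau> q *\<^sub>R (?p - ?m ?p) = q"
        unfolding mp using \<tau> by (simp add: \<pi>_def)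
      ultimately show "q \<in> U" using sub by auto
    qed
  qed
  then obtain W where W: "open W" "q0 \<in> W" "\<And>q. q \<in> W \<Longrightarrow> q \<in> trace_space t \<Longrightarrow> q \<in> U"
    unfolding eventually_nhds by blast
  have "symmetric q0"
    using s0 symmetric_barycentre[OF s0(1)] by (simp add: q0_def vec_eq_iff transpose_def)
  moreover have "trace q0 = t"
    unfolding q0_def linear_add[OF linear_trace] linear_cmul[OF linear_trace]
      linear_diff[OF linear_trace] trace_barycentre s0(2) by simp
  ultimately have "q0 \<in> trace_space t \<inter> W" using W(2) by (simp add: trace_space_def)
  moreover have "openin (top_of_set (trace_space t)) (trace_space t \<inter> W)"
    using W(1) by (rule openin_open_Int)
  ultimately show ?thesis
    unfolding interior_of_def using W(3) by blast
qed

end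

text \<open>The hull lies in the half-space \<open>c \<le> \<Lambda>\<close>. From \<open>p\<close> on its bounding hyperplane, moving along the
line through \<open>y\<close> leaves this half-space on one of the two sides.\<close>

lemma frontier_rank_one_hull:
  fixes \<Lambda> :: "real^3^3 \<Rightarrow> real"
  assumes L: "linear \<Lambda>" and E: "E \<noteq> {}" "E \<subseteq> trace_space t" and ge: "\<And>x. x \<in> E \<Longrightarrow> c \<le> \<Lambda> x"
    and p: "p \<in> rank_one_hull E" "\<Lambda> p = c" and y: "y \<in> trace_space t" "\<Lambda> y \<noteq> c"
  shows "p \<in> (top_of_set (trace_space t)) frontier_of (rank_one_hull E)"
proof -
  have sub: "rank_one_hull E \<subseteq> trace_space t" by (rule rank_one_hull_trace_space[OF E(2,1)])
  then have pt: "p \<in> trace_space t" using p by blast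
  have "p \<in> (top_of_set (trace_space t)) closure_of (rank_one_hull E)"
    using closure_of_subset[of "rank_one_hull E" "top_of_set (trace_space t)"] sub p by auto
  moreover have "p \<notin> (top_of_set (trace_space t)) interior_of (rank_one_hull E)"
  proof
    assume "p \<in> (top_of_set (trace_space t)) interior_of (rank_one_hull E)"
    then obtain W where W: "open W" "p \<in> W" "trace_space t \<inter> W \<subseteq> rank_one_hull E"
      unfolding interior_of_def openin_open by blast
    define x where "x s = p + s *\<^sub>R (y - p)" for s :: real
    have "isCont x 0" unfolding x_def by (intro continuous_intros)
    from isCont_eventually_nhds[OF this W(1)] W(2)
    have "\<forall>\<^sub>F s in nhds 0. x s \<in> W" by (simp add: x_def)
    then obtain e where e: "e > 0" "\<And>s. \<bar>s\<bar> < e \<Longrightarrow> x s \<in> W"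
      unfolding eventually_nhds_metric by (auto simp: dist_real_def)
    define s where "s = (if \<Lambda> y < c then e / 2 else - e / 2)"
    have "\<bar>s\<bar> < e" using e by (auto simp: s_def)
    then have "x s \<in> W" by (rule e)
    moreover have "x s \<in> trace_space t"
    proof -
      have "symmetric (x s)"
        using pt y by (simp add: x_def trace_space_def vec_eq_iff transpose_def)
      moreover have "trace (x s) = t"
        using pt y unfolding x_def linear_add[OF linear_trace] linear_cmul[OF linear_trace]
          linear_diff[OF linear_trace] by (simp add: trace_space_def)
      ultimately show ?thesis by (simp add: trace_space_def)
    qed
    ultimately have "c \<le> \<Lambda> (x s)"
      using rank_one_hull_linear_bound[OF L ge E(1)] W(3) by blast
    moreover have "\<Lambda> (x s) = c + s * (\<Lambda> y - c)"
      using L p by (simp add: x_def linear_add linear_cmul linear_diff)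
    moreover have "s * (\<Lambda> y - c) < 0"
      using e(1) y(2) by (auto simp: s_def mult_pos_neg mult_less_0_iff)
    ultimately show False by simp
  qed
  ultimately show ?thesis by (simp add: frontier_of_def)
qed

section \<open>A triple and its dual\<close>

lemma orbit3_values:
  "orbit3 R p 1 = p" "orbit3 R p 2 = conj_act R p" "orbit3 R p 3 = conj_act R (conj_act R p)"
  by (simp_all add: orbit3_def)

lemma orbit3_cyclic:
  assumes "threefold (conj_act R)"
  shows "orbit3 R p (i + 1) = conj_act R (orbit3 R p i)"
proof -
  have "orbit3 R p 4 = orbit3 R p 1" by (rule arg_cong[of _ _ "orbit3 R p"]) simp
  then show ?thesis
    using exhaust_3[of i] orbit3_values[of R p] threefoldD(2)[OF assms] by auto
qed

lemma is_symmetric_T3_orbit3: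
  assumes "threefold (conj_act R)" "symmetric p" "det (p - conj_act R p) \<noteq> 0"
  shows "is_symmetric_T3 (orbit3 R p)"
  by (rule is_symmetric_T3_cyclic[where e = "orbit3 R p" and g = "conj_act R",
        OF assms(1) orbit3_cyclic[OF assms(1)]])
     (use assms in \<open>simp_all add: orbit3_def\<close>)

lemma range_orbit3: "range (orbit3 R p) = orbit_set (conj_act R) p"
  unfolding UNIV_3 image_insert image_empty orbit3_values orbit_set_def ..

text \<open>Each vertex is on the line through two nodes (\<open>node_step\<close>), which are distinct unless
\<open>l = 1/2\<close>.\<close>

lemma vertex_in_affine_hull_nodes:
  assumes g: "threefold g" and l: "0 < l" "l < 1" "l \<noteq> 1/2" and x: "x \<in> orbit_set g p"
  shows "x \<in> affine hull (node g l ` orbit_set g p)"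
proof -
  define y where "y = g (g x)"
  have y: "y \<in> orbit_set g p" "g y \<in> orbit_set g p" "g y = x"
    using orbit_set_closed[OF g] x threefoldD(2)[OF g] by (simp_all add: y_def)
  define c where "c = l / (1 - l)"
  have c: "c \<noteq> 1" using l by (auto simp: c_def field_simps)
  have "node g l (g y) = c *\<^sub>R node g l y + (1 - c) *\<^sub>R x"
    using node_step[OF g l(1,2), of y] by (simp add: node_equivariant[OF g] c_def y(3))
  then have "(1 - c) *\<^sub>R x = node g l (g y) - c *\<^sub>R node g l y" by simp
  then have "(1 / (1 - c)) *\<^sub>R ((1 - c) *\<^sub>R x) = (1 / (1 - c)) *\<^sub>R (node g l (g y) - c *\<^sub>R node g l y)"
    by (rule arg_cong)
  then have "x = (1 / (1 - c)) *\<^sub>R node g l (g y) + (- c / (1 - c)) *\<^sub>R node g l y"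
    using c by (simp add: scaleR_diff_right)
  moreover have "1 / (1 - c) + (- c / (1 - c)) = 1" using c by (simp add: field_simps)
  ultimately show ?thesis
    using mem_affine[OF affine_affine_hull] hull_inc y(1,2) by (metis imageI)
qed

text \<open>Here \<open>g\<close> is the rotation of the triple whose nodes are mixed and \<open>conj_act R\<close> that of the
neighbouring triple. The point \<open>b\<close> stands for the strain that they share: it need not be a mixture of nodes,
but it lies in their affine hull, which suffices for the polynomial conditions to hold
at some mixture.\<close>

lemma triple_and_dual:
  fixes e e' :: "3 \<Rightarrow> real^3^3" and \<Lambda> :: "real^3^3 \<Rightarrow> real"
  assumes g: "threefold g"
    and q: "strain_symmetry q" "\<And>X. q (q X) = X" "\<And>X. q (g (q X)) = g (g X)"
    and e: "range e = orbit_set g a" "range e' = orbit_set g (q a)"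
    and a: "symmetric a" "det (a - g a) \<noteq> 0" "inner_det g a (1/2) \<noteq> 0"
    and L: "linear \<Lambda>"
    and A: "A = {X. symmetric X \<and> trace X = t \<and> \<Lambda> X = c}"
      "aff_dim A = 4" "affine hull (orbit_set g a \<union> orbit_set g (q a)) = A"
    and r: "threefold (conj_act R)" and b: "b \<in> A" "det (b - conj_act R b) \<noteq> 0"
      "inner_det (conj_act R) b (1/2) \<noteq> 0" "\<Lambda> (barycentre (conj_act R) b) \<noteq> c"
    and E: "finite E" "orbit_set g a \<subseteq> E" "orbit_set g (q a) \<subseteq> E" "E \<subseteq> trace_space t"
      "below \<Longrightarrow> \<forall>x\<in>E. c \<le> \<Lambda> x"
  shows "let n = T3_node e; n' = T3_node e'; C = convex hull (range n \<union> range n') in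
    aff_dim C = 4 \<and>
    (\<forall>w\<in>weights.
       mixture n n' w \<in> C \<and>
       mixture n n' w \<in> lamination_hull (range n \<union> range n') \<and>
       (\<not> compatible (mixture n n' w) (conj_act R (mixture n n' w)) \<longrightarrow>
          is_symmetric_T3 (orbit3 R (mixture n n' w)))) \<and>
    generically_on C (\<lambda>p. is_symmetric_T3 (orbit3 R p)) \<and>
    five_dimensional t (T3_union R n n') \<and>
    (below \<longrightarrow>
       T3_union R n n' \<inter>
         (top_of_set (trace_space t)) frontier_of (rank_one_hull E) \<noteq> {})"
proof -
  let ?r = "conj_act R"
  define n where "n = T3_node e"
  define n' where "n' = T3_node e'"
  obtain l where l: "0 < l" "l < 1" "inner_det g a l = 0" using inner_det_root_exists[OF g a(2)] .
  have half: "l \<noteq> 1/2" using l(3) a(3) by metis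
  define N where "N = node g l ` orbit_set g a"
  have qa: "symmetric (q a)" "det (q a - g (q a)) \<noteq> 0" "inner_det g (q a) (1 - l) = 0"
    using strain_symmetry_symmetric[OF q(1) a(1)] det_dual[OF g q] inner_det_dual[OF g q] a l by auto
  have n: "range n = N"
    unfolding n_def N_def using range_T3_node[OF g e(1) a(1,2) l] .
  have n': "range n' = q ` N"
    unfolding n'_def N_def node_image_dual[OF g q, symmetric]
    using range_T3_node[OF g e(2) qa(1,2) _ _ qa(3)] l by simp
  define C where "C = convex hull (range n \<union> range n')"
  have compat: "compatible x y" if "x \<in> range n \<union> range n'" "y \<in> range n \<union> range n'" for x y
    using six_nodes_compatible[OF g q a(1) l N_def] that unfolding n n' by blast
  have fin: "finite (range n \<union> range n')" by simp
  have lam: "C \<subseteq> lamination_hull (range n \<union> range n')"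
    unfolding C_def by (rule convex_hull_subset_lamination_hull[OF fin compat])
  have affA: "affine A"
    unfolding A(3)[symmetric] by (rule affine_affine_hull)
  have "node g k x \<in> affine hull (orbit_set g p)" if x: "x \<in> orbit_set g p" for k x p
  proof -
    let ?D = "1 - k + k^2"
    have D: "?D \<noteq> 0" using node_denominator_pos[of k] by simp
    have "((1 - k)^2 / ?D) + (k^2 / ?D) + (k * (1 - k) / ?D) = 1"
    proof -
      have "(1 - k)^2 + k^2 + k * (1 - k) = ?D" by algebra
      then show ?thesis using D unfolding add_divide_distrib[symmetric] by simp
    qed
    moreover have "x \<in> affine hull (orbit_set g p)" "g x \<in> affine hull (orbit_set g p)"
      "g (g x) \<in> affine hull (orbit_set g p)"
      using x orbit_set_closed[OF g] hull_inc by metis+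
    ultimately have "((1 - k)^2 / ?D) *\<^sub>R x + (k^2 / ?D) *\<^sub>R g x + (k * (1 - k) / ?D) *\<^sub>R g (g x)
        \<in> affine hull (orbit_set g p)"
      using mem_affine_3[OF affine_affine_hull] by blast
    then show ?thesis by (simp add: node_def scaleR_add_right)
  qed
  then have "range n \<union> range n' \<subseteq> affine hull (orbit_set g a) \<union> affine hull (orbit_set g (q a))"
    unfolding n n' N_def node_image_dual[OF g q, symmetric] by blast
  also have "\<dots> \<subseteq> A"
    unfolding A(3)[symmetric] by (simp add: hull_mono)
  finally have hullC: "affine hull C \<subseteq> A"
    unfolding C_def affine_hull_convex_hull using affA by (simp add: hull_minimal)
  have "orbit_set g a \<subseteq> affine hull N" "orbit_set g (q a) \<subseteq> affine hull (q ` N)"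
    unfolding N_def node_image_dual[OF g q, symmetric]
    using vertex_in_affine_hull_nodes[OF g] l half by (auto simp: field_simps)
  then have "orbit_set g a \<union> orbit_set g (q a) \<subseteq> affine hull (N \<union> q ` N)"
    using hull_mono[of N "N \<union> q ` N" affine] hull_mono[of "q ` N" "N \<union> q ` N" affine] by blast
  then have "A \<subseteq> affine hull C"
    unfolding A(3)[symmetric] C_def affine_hull_convex_hull n n'
    by (simp add: hull_minimal affine_affine_hull)
  with hullC have affC: "affine hull C = A" by blast
  then have dim: "aff_dim C = 4" using aff_dim_affine_hull[of C] A(2) by simp
  have CA: "C \<subseteq> A" using affC hull_subset[of C affine] by blast
  have symC: "symmetric p" if "p \<in> C" for p using CA that unfolding A by blast
  have T3: "is_symmetric_T3 (orbit3 R p)" if "p \<in> C" "det (p - ?r p) \<noteq> 0" for p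
    using is_symmetric_T3_orbit3[OF r symC] that by blast
  have incompatible: "\<not> compatible p (?r p) \<longleftrightarrow> det (p - ?r p) \<noteq> 0" if "p \<in> C" for p
    using compatible_iff_det[OF symC[OF that] strain_symmetry_symmetric[OF threefoldD(1)[OF r] symC[OF that]]]
      strain_symmetryD(3)[OF threefoldD(1)[OF r], of p] by simp
  have weights: "mixture n n' ` weights = C"
    unfolding C_def by (rule mixture_image_weights)
  have U: "T3_union R n n' = (\<Union>p\<in>{p\<in>C. is_T3 (orbit3 R p)}. rank_one_hull (orbit_set ?r p))"
    unfolding T3_union_def weights range_orbit3 ..
  have is_T3: "is_T3 (orbit3 R p)" if "p \<in> C" "det (p - ?r p) \<noteq> 0" for p
    using T3[OF that] unfolding is_symmetric_T3_def is_T3_def by blast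
  have sub: "rank_one_hull (orbit_set ?r p) \<subseteq> T3_union R n n'" if "p \<in> C" "det (p - ?r p) \<noteq> 0" for p
    unfolding U using is_T3[OF that] that by blast
  have convC: "convex C" unfolding C_def by (rule convex_convex_hull)
  obtain p0 where p0: "p0 \<in> rel_interior C" "det (p0 - ?r p0) \<noteq> 0" "inner_det ?r p0 (1/2) \<noteq> 0"
    "\<Lambda> (barycentre ?r p0) \<noteq> c"
    using generic_point[OF r L convC] b affC by metis
  have p0C: "p0 \<in> C" using p0(1) rel_interior_subset by blast
  have 1: "\<forall>w\<in>weights. mixture n n' w \<in> C \<and>
       mixture n n' w \<in> lamination_hull (range n \<union> range n') \<and>
       (\<not> compatible (mixture n n' w) (?r (mixture n n' w)) \<longrightarrow>
          is_symmetric_T3 (orbit3 R (mixture n n' w)))"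
    using weights lam T3 incompatible by blast
  have 2: "generically_on C (\<lambda>p. is_symmetric_T3 (orbit3 R p))"
    unfolding generically_on_def
  proof (intro exI conjI)
    have lr: "linear ?r" by (rule linear_conj_act)
    show "real_polynomial_function (\<lambda>p. det (p - ?r p))"
      by (rule real_polynomial_function_det, rule linearI)
         (simp_all add: linear_add[OF lr] linear_cmul[OF lr] algebra_simps)
    show "\<exists>x\<in>C. det (x - ?r x) \<noteq> 0" using p0 p0C by blast
    show "\<forall>x\<in>C. det (x - ?r x) \<noteq> 0 \<longrightarrow> is_symmetric_T3 (orbit3 R x)" using T3 by blast
  qed
  have "rank_one_hull (orbit_set ?r p) \<subseteq> trace_space t" if "p \<in> C" for p
  proof (rule rank_one_hull_trace_space)
    show "orbit_set ?r p \<subseteq> trace_space t"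
      using CA that strain_symmetry_symmetric[OF threefoldD(1)[OF r]]
        strain_symmetryD(3)[OF threefoldD(1)[OF r]]
      unfolding A orbit_set_def trace_space_def by auto
  qed (simp add: orbit_set_def)
  then have "T3_union R n n' \<subseteq> trace_space t" unfolding U by blast
  then have 3: "five_dimensional t (T3_union R n n')"
    unfolding five_dimensional_def
    using five_dimensional_union[OF r L affC[unfolded A(1)] p0] sub by blast
  have 4: "T3_union R n n' \<inter> (top_of_set (trace_space t)) frontier_of (rank_one_hull E) \<noteq> {}"
    if below
  proof -
    have vE: "rank_one_hull (orbit_set g p) \<subseteq> rank_one_hull E" if "orbit_set g p \<subseteq> E" for p
    proof (rule rank_one_hull_minimal)
      show "orbit_set g p \<subseteq> rank_one_hull E"
        using that E(1,4) rank_one_hull_inc[OF E(1)] unfolding trace_space_def by blast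
    qed (simp add: orbit_set_def)
    have "range n \<subseteq> rank_one_hull E"
      unfolding n N_def using node_in_hull[OF g a(1) l(1,2) half l(3)] vE[OF E(2)] by blast
    moreover have "range n' \<subseteq> rank_one_hull E"
      unfolding n' N_def node_image_dual[OF g q, symmetric]
      using node_in_hull[OF g qa(1) _ _ _ qa(3)] vE[OF E(3)] l half by (auto simp: field_simps)
    ultimately have "C \<subseteq> rank_one_hull E"
      unfolding C_def
      by (intro convex_hull_subset_lamination_convex[OF fin compat lamination_convex_rank_one_hull]) auto
    then have p0E: "p0 \<in> rank_one_hull E" using p0C by blast
    have p0A: "symmetric p0" "trace p0 = t" "\<Lambda> p0 = c" using p0C CA unfolding A by auto
    have "barycentre ?r p0 \<in> trace_space t"
      using symmetric_barycentre[OF r p0A(1)] trace_barycentre[OF r] p0A(2)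
      by (simp add: trace_space_def)
    moreover have "E \<noteq> {}" using E(2) by (auto simp: orbit_set_def)
    ultimately have "p0 \<in> (top_of_set (trace_space t)) frontier_of (rank_one_hull E)"
      using frontier_rank_one_hull[OF L _ E(4) _ p0E p0A(3)] E(5)[OF that] p0(4) by blast
    moreover have "p0 \<in> T3_union R n n'"
      using sub[OF p0C p0(2)] rank_one_hull_inc[of "orbit_set ?r p0" p0] p0A(1)
      by (auto simp: orbit_set_def)
    ultimately show ?thesis by blast
  qed
  show ?thesis
    unfolding Let_def n_def[symmetric] n'_def[symmetric] C_def[symmetric]
    using dim 1 2 3 4 by blast
qed

section \<open>The triples of strains\<close>

lemma symmat_nth [simp]:
  "symmat a b c p q s $ 1 $ 1 = a" "symmat a b c p q s $ 1 $ 2 = p" "symmat a b c p q s $ 1 $ 3 = q"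
  "symmat a b c p q s $ 2 $ 1 = p" "symmat a b c p q s $ 2 $ 2 = b" "symmat a b c p q s $ 2 $ 3 = s"
  "symmat a b c p q s $ 3 $ 1 = q" "symmat a b c p q s $ 3 $ 2 = s" "symmat a b c p q s $ 3 $ 3 = c"
  by (simp_all add: symmat_def)

lemma matrix3_eq_iff: "A = B \<longleftrightarrow> (\<forall>i\<in>{1,2,3}. \<forall>j\<in>{1,2,3}. A $ i $ j = B $ i $ j)" for A B :: "real^3^3"
  by (simp add: vec_eq_iff forall_3)

lemma symmetric_symmat: "symmetric (symmat a b c p q s)"
  by (simp add: matrix3_eq_iff transpose_def)

lemma trace_symmat: "trace (symmat a b c p q s) = a + b + c"
  by (simp add: trace_def sum_3)

lemma symmetric_eq_symmat:
  assumes "symmetric X"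
  shows "X = symmat (X$1$1) (X$2$2) (X$3$3) (X$1$2) (X$1$3) (X$2$3)"
  unfolding matrix3_eq_iff
  using symmetric_nth[OF assms, of 2 1] symmetric_nth[OF assms, of 3 1] symmetric_nth[OF assms, of 3 2]
  by simp

lemma symmat_cong:
  "\<lbrakk>a = a'; b = b'; c = c'; p = p'; q = q'; s = s'\<rbrakk> \<Longrightarrow> symmat a b c p q s = symmat a' b' c' p' q' s'"
  by simp

lemma symmat_linear:
  "symmat a b c p q s + symmat a' b' c' p' q' s'
    = symmat (a + a') (b + b') (c + c') (p + p') (q + q') (s + s')"
  "symmat a b c p q s - symmat a' b' c' p' q' s'
    = symmat (a - a') (b - b') (c - c') (p - p') (q - q') (s - s')"
  "k *\<^sub>R symmat a b c p q s = symmat (k * a) (k * b) (k * c) (k * p) (k * q) (k * s)"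
  by (simp_all add: matrix3_eq_iff)

lemma det_symmat: "det (symmat a b c p q s) = a * b * c + 2 * p * q * s - a * s^2 - b * q^2 - c * p^2"
  by (simp add: det_3 power2_eq_square algebra_simps)

text \<open>All eight \<open>T\<^sub>3\<close>s arise from this family with signs \<open>x, y\<close> and \<open>\<eta> = \<plusminus> \<epsilon>\<close>. The triple for signs
\<open>x, y\<close> is the conjugate of the one for \<open>x = y = 1\<close> by the diagonal matrix with entries \<open>x, y, 1\<close>. Its axis
is \<open>(x, y, 1)\<close>, and the dual triple has \<open>- \<eta>\<close> in place of \<open>\<eta>\<close>.\<close>

definition triple1 where "triple1 \<alpha> \<beta> \<delta> x y \<eta> = symmat \<alpha> \<alpha> \<beta> (-(x*y*\<delta>)) (-(x*\<eta>)) (y*\<eta>)"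
definition triple2 where "triple2 \<alpha> \<beta> \<delta> x y \<eta> = symmat \<alpha> \<beta> \<alpha> (x*y*\<eta>) (-(x*\<delta>)) (-(y*\<eta>))"
definition triple3 where "triple3 \<alpha> \<beta> \<delta> x y \<eta> = symmat \<beta> \<alpha> \<alpha> (-(x*y*\<eta>)) (x*\<eta>) (-(y*\<delta>))"

lemmas triple_defs = triple1_def triple2_def triple3_def

lemma symmetric_triple:
  "symmetric (triple1 \<alpha> \<beta> \<delta> x y \<eta>)" "symmetric (triple2 \<alpha> \<beta> \<delta> x y \<eta>)"
  "symmetric (triple3 \<alpha> \<beta> \<delta> x y \<eta>)"
  by (simp_all add: triple_defs symmetric_symmat)

lemma trace_triple:
  "trace (triple1 \<alpha> \<beta> \<delta> x y \<eta>) = 2 * \<alpha> + \<beta>" "trace (triple2 \<alpha> \<beta> \<delta> x y \<eta>) = 2 * \<alpha> + \<beta>"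
  "trace (triple3 \<alpha> \<beta> \<delta> x y \<eta>) = 2 * \<alpha> + \<beta>"
  by (simp_all add: triple_defs trace_symmat)

definition cycle_matrix :: "real \<Rightarrow> real \<Rightarrow> real^3^3" where
  "cycle_matrix x y = vector [vector [0, x*y, 0], vector [0, 0, y], vector [x, 0, 0]]"

text \<open>The negative of this matrix is a half turn, which acts in the same way. It inverts the cycle
and exchanges the triples for \<open>\<eta>\<close> and \<open>- \<eta>\<close>.\<close>

definition swap_matrix :: "real \<Rightarrow> real \<Rightarrow> real^3^3" where
  "swap_matrix x y = vector [vector [0, x*y, 0], vector [x*y, 0, 0], vector [0, 0, 1]]"

text \<open>On symmetric matrices of fixed trace this is, up to a constant and a factor two, the quadratic
form of \<open>X\<close> at the axis \<open>(x, y, 1)\<close>.\<close>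

definition axis_value :: "real \<Rightarrow> real \<Rightarrow> real^3^3 \<Rightarrow> real" where
  "axis_value x y X = x*y * X$1$2 + x * X$1$3 + y * X$2$3"

lemma linear_axis_value: "linear (axis_value x y)"
  by (rule linearI) (simp_all add: axis_value_def algebra_simps)

context
  fixes x y :: real
  assumes xy: "x = 1 \<or> x = -1" "y = 1 \<or> y = -1"
begin

lemma cycle_matrix_orthogonal: "orthogonal_matrix (cycle_matrix x y)"
  using xy unfolding orthogonal_matrix cycle_matrix_def
  by (auto simp: matrix3_eq_iff matrix_matrix_mult_def sum_3 transpose_def mat_def)

lemma swap_matrix_orthogonal: "orthogonal_matrix (swap_matrix x y)"
  using xy unfolding orthogonal_matrix swap_matrix_def
  by (auto simp: matrix3_eq_iff matrix_matrix_mult_def sum_3 transpose_def mat_def)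

lemma cycle_swap_relations:
  "cycle_matrix x y ** (cycle_matrix x y ** cycle_matrix x y) = mat 1"
  "swap_matrix x y ** swap_matrix x y = mat 1"
  "swap_matrix x y ** (cycle_matrix x y ** swap_matrix x y) = cycle_matrix x y ** cycle_matrix x y"
  using xy unfolding swap_matrix_def cycle_matrix_def
  by (auto simp: matrix3_eq_iff matrix_matrix_mult_def sum_3 mat_def)

lemma threefold_cycle: "threefold (conj_act (cycle_matrix x y))"
  unfolding threefold_def
  using strain_symmetry_conj_act[OF cycle_matrix_orthogonal] cycle_swap_relations(1)
  by (simp add: conj_act_mat_1 flip: conj_act_mult)

lemma swap_involution:
  "strain_symmetry (conj_act (swap_matrix x y))"
  "conj_act (swap_matrix x y) (conj_act (swap_matrix x y) X) = X"
  "conj_act (swap_matrix x y) (conj_act (cycle_matrix x y) (conj_act (swap_matrix x y) X))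
    = conj_act (cycle_matrix x y) (conj_act (cycle_matrix x y) X)"
  using strain_symmetry_conj_act[OF swap_matrix_orthogonal] cycle_swap_relations(2,3)
  by (simp_all add: conj_act_mat_1 flip: conj_act_mult)

lemma conj_act_cycle_symmat:
  "conj_act (cycle_matrix x y) (symmat a b c p q s) = symmat b c a (x * s) (y * p) (x * y * q)"
  using xy unfolding conj_act_def cycle_matrix_def
  by (auto simp: matrix3_eq_iff matrix_matrix_mult_def sum_3 transpose_def)

lemma conj_act_swap_symmat:
  "conj_act (swap_matrix x y) (symmat a b c p q s) = symmat b a c p (x * y * s) (x * y * q)"
  using xy unfolding conj_act_def swap_matrix_def
  by (auto simp: matrix3_eq_iff matrix_matrix_mult_def sum_3 transpose_def)

context
  fixes \<alpha> \<beta> \<delta> \<eta> :: real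
begin

abbreviation "v1 \<equiv> triple1 \<alpha> \<beta> \<delta> x y \<eta>"
abbreviation "v2 \<equiv> triple2 \<alpha> \<beta> \<delta> x y \<eta>"
abbreviation "v3 \<equiv> triple3 \<alpha> \<beta> \<delta> x y \<eta>"

lemma cycle_triple:
  "conj_act (cycle_matrix x y) v1 = v2" "conj_act (cycle_matrix x y) v2 = v3"
  using xy by (auto simp: triple_defs conj_act_cycle_symmat)

lemma orbit_triple: "orbit_set (conj_act (cycle_matrix x y)) v1 = {v1, v2, v3}"
  by (simp add: orbit_set_def cycle_triple)

lemma swap_triple: "conj_act (swap_matrix x y) v1 = triple1 \<alpha> \<beta> \<delta> x y (-\<eta>)"
  using xy by (auto simp: triple_defs conj_act_swap_symmat)

lemma axis_value_triple:
  "axis_value x y v1 = - \<delta>" "axis_value x y v2 = - \<delta>" "axis_value x y v3 = - \<delta>"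
  using xy by (auto simp: triple_defs axis_value_def)

lemma det_triple:
  "det (v1 - conj_act (cycle_matrix x y) v1) = 4 * \<eta> * ((\<alpha> - \<beta>) * \<delta> + \<eta>^2 - \<delta>^2)"
  unfolding cycle_triple unfolding triple_defs symmat_linear det_symmat
  by (rule disjE[OF xy(1)]; rule disjE[OF xy(2)]; simp add: power2_eq_square algebra_simps)

lemma inner_det_triple:
  "8 * inner_det (conj_act (cycle_matrix x y)) v1 (1/2)
    = 2 * (\<alpha> - \<beta>)^3 - 6 * (\<alpha> - \<beta>) * \<delta>^2 + 18 * (\<alpha> - \<beta>) * \<eta>^2 + 4 * \<delta>^3 - 36 * \<delta> * \<eta>^2"
  unfolding inner_det_def cycle_triple unfolding triple_defs symmat_linear det_symmat
  by (rule disjE[OF xy(1)]; rule disjE[OF xy(2)]; simp add: power2_eq_square power3_eq_cube field_simps)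

end

text \<open>Explicit barycentric coordinates with respect to the six vertices: the diagonal of \<open>X\<close>
determines the sums of the weights of dual vertices, the off-diagonal entries the differences of these
weights up to a common constant.\<close>

lemma axis_space_subset:
  fixes \<alpha> \<beta> \<delta> \<eta> :: real
  assumes "\<alpha> \<noteq> \<beta>" "\<eta> \<noteq> 0"
    and X: "symmetric X" "trace X = 2 * \<alpha> + \<beta>" "axis_value x y X = - \<delta>"
    and S: "affine S" "{triple1 \<alpha> \<beta> \<delta> x y \<eta>, triple2 \<alpha> \<beta> \<delta> x y \<eta>, triple3 \<alpha> \<beta> \<delta> x y \<eta>} \<union>
      {triple1 \<alpha> \<beta> \<delta> x y (-\<eta>), triple2 \<alpha> \<beta> \<delta> x y (-\<eta>), triple3 \<alpha> \<beta> \<delta> x y (-\<eta>)} \<subseteq> S"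
  shows "X \<in> S"
proof -
  define k where "k = \<beta> - \<alpha>"
  have k: "k \<noteq> 0" using assms(1) by (simp add: k_def)
  define s1 s2 s3 where s: "s1 = (X$3$3 - \<alpha>) / k" "s2 = (X$2$2 - \<alpha>) / k" "s3 = (X$1$1 - \<alpha>) / k"
  have ks: "X$3$3 = \<alpha> + k * s1" "X$2$2 = \<alpha> + k * s2" "X$1$1 = \<alpha> + k * s3"
    using k by (simp_all add: s)
  have "k * (s1 + s2 + s3) = k * 1"
    using X(2) ks by (simp add: trace_def sum_3 k_def algebra_simps)
  then have "s1 + s2 + s3 = 1" using k mult_left_cancel by blast
  then have s1: "s1 = 1 - s2 - s3" by simp
  define d2 where "d2 = - (y * X$2$3 + \<delta> * s3) / \<eta>"
  define d3 where "d3 = (x * X$1$3 + \<delta> * s2) / \<eta>"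
  have off: "y * X$2$3 = - (\<eta> * d2) - \<delta> * s3" "x * X$1$3 = \<eta> * d3 - \<delta> * s2"
    using assms(2) by (simp_all add: d2_def d3_def)
  then have off1: "x * y * X$1$2 = \<eta> * (d2 - d3) - \<delta> * s1"
    using X(3) by (simp add: axis_value_def s1 algebra_simps)
  have inv: "X$2$3 = y * (y * X$2$3)" "X$1$3 = x * (x * X$1$3)" "X$1$2 = x * y * (x * y * X$1$2)"
    using xy by auto
  let ?u1 = "triple1 \<alpha> \<beta> \<delta> x y \<eta>"
  have "X = ?u1 + (s1/2) *\<^sub>R (triple1 \<alpha> \<beta> \<delta> x y (-\<eta>) - ?u1)
      + ((s2 + d2)/2) *\<^sub>R (triple2 \<alpha> \<beta> \<delta> x y \<eta> - ?u1) + ((s2 - d2)/2) *\<^sub>R (triple2 \<alpha> \<beta> \<delta> x y (-\<eta>) - ?u1)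
      + ((s3 + d3)/2) *\<^sub>R (triple3 \<alpha> \<beta> \<delta> x y \<eta> - ?u1) + ((s3 - d3)/2) *\<^sub>R (triple3 \<alpha> \<beta> \<delta> x y (-\<eta>) - ?u1)"
    (is "_ = ?Y")
  proof -
    have "X = symmat (\<alpha> + k * s3) (\<alpha> + k * s2) (\<alpha> + k * s1)
        (x * y * (\<eta> * (d2 - d3) - \<delta> * s1)) (x * (\<eta> * d3 - \<delta> * s2)) (y * (- (\<eta> * d2) - \<delta> * s3))"
      unfolding off[symmetric] off1[symmetric] ks[symmetric] inv[symmetric]
      by (rule symmetric_eq_symmat[OF X(1)])
    also have "\<dots> = ?Y"
      unfolding triple1_def triple2_def triple3_def symmat_linear s1 k_def
      by (rule symmat_cong) (simp_all add: field_simps)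
    finally show ?thesis .
  qed
  moreover have "?Y \<in> S"
    by (intro mem_affine_3_minus[OF S(1)]) (use S(2) in auto)
  ultimately show ?thesis by simp
qed

lemma aff_dim_axis_space:
  "aff_dim {X :: real^3^3. symmetric X \<and> trace X = t \<and> axis_value x y X = c} = 4"
proof -
  define \<Phi> :: "real^4 \<Rightarrow> real^3^3" where
    "\<Phi> v = symmat (v$1) (v$2) (- v$1 - v$2) (x*y * v$3) (x * v$4) (- (y * (v$3 + v$4)))" for v
  have lin: "linear \<Phi>"
    by (rule linearI) (simp_all add: \<Phi>_def symmat_linear algebra_simps)
  have inj: "inj \<Phi>"
  proof (rule injI)
    fix v w assume "\<Phi> v = \<Phi> w"
    then have e: "\<Phi> v $ i $ j = \<Phi> w $ i $ j" for i j by simp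
    have "x \<noteq> 0" "y \<noteq> 0" using xy by auto
    then have "v$1 = w$1" "v$2 = w$2" "v$3 = w$3" "v$4 = w$4"
      using e[of 1 1] e[of 2 2] e[of 1 2] e[of 1 3] unfolding \<Phi>_def symmat_nth by simp_all
    then show "v = w" by (simp add: vec_eq_iff forall_4)
  qed
  define Y where "Y = symmat t 0 0 0 (x * c) 0"
  have "X \<in> (+) Y ` range \<Phi>" if X: "symmetric X" "trace X = t" "axis_value x y X = c" for X
  proof -
    let ?v = "\<chi> i::4. if i = 1 then X$1$1 - t else if i = 2 then X$2$2 else
      if i = 3 then x * y * X$1$2 else x * X$1$3 - c"
    have v: "?v $ 1 = X$1$1 - t" "?v $ 2 = X$2$2" "?v $ 3 = x * y * X$1$2" "?v $ 4 = x * X$1$3 - c"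
      by simp_all
    have tr: "X$3$3 = t - X$1$1 - X$2$2" using X(2) by (simp add: trace_def sum_3)
    have ax: "y * X$2$3 = c - x * y * X$1$2 - x * X$1$3" using X(3) by (simp add: axis_value_def)
    have "X$2$3 = y * (y * X$2$3)" using xy by auto
    then have ax': "X$2$3 = y * (c - x * y * X$1$2 - x * X$1$3)" unfolding ax .
    have "Y + \<Phi> ?v = symmat (X$1$1) (X$2$2) (X$3$3) (X$1$2) (X$1$3) (X$2$3)"
      unfolding \<Phi>_def v Y_def symmat_linear tr ax'
      using xy by (auto simp: algebra_simps)
    then have "X = Y + \<Phi> ?v" using symmetric_eq_symmat[OF X(1)] by simp
    then show ?thesis by blast
  qed
  moreover have "symmetric (Y + \<Phi> v) \<and> trace (Y + \<Phi> v) = t \<and> axis_value x y (Y + \<Phi> v) = c" for v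
    unfolding Y_def \<Phi>_def symmat_linear using xy
    by (auto simp: symmetric_symmat trace_symmat axis_value_def algebra_simps)
  ultimately have eq: "{X. symmetric X \<and> trace X = t \<and> axis_value x y X = c} = (+) Y ` range \<Phi>"
    by blast
  have "aff_dim (range \<Phi>) = int (dim (range \<Phi>))"
    using linear_subspace_image[OF lin subspace_UNIV] by (rule aff_dim_subspace)
  also have "dim (range \<Phi>) = dim (UNIV :: (real^4) set)"
    using lin inj by (intro dim_image_eq) auto
  finally show ?thesis
    unfolding eq aff_dim_translation_eq by (simp add: dim_UNIV)
qed

end

section \<open>Rotations of a triple\<close>

lemma cube_rotation_signed_permutation:
  assumes "R \<in> cube_rotations"
  shows "orthogonal_matrix R \<and> (\<forall>i j. R $ i $ j \<in> {-1, 0, 1})"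
  using assms
proof induction
  case one
  show ?case using orthogonal_matrix_id by (auto simp: mat_def)
next
  case (step R Q)
  have "orthogonal_matrix Q"
    using step.hyps(2) unfolding quarter_turns_def orthogonal_matrix
    by (auto simp: matrix3_eq_iff matrix_matrix_mult_def sum_3 transpose_def mat_def)
  then have "orthogonal_matrix (R ** Q)" using step.IH orthogonal_matrix_mul by blast
  moreover have "(R ** Q) $ i $ j \<in> {-1, 0, 1}" for i j
  proof -
    define S where "S = {-1, 0, 1 :: real}"
    have "R $ i $ k \<in> S" "- (R $ i $ k) \<in> S" for k
      using step.IH unfolding S_def by (force, metis (no_types) insert_iff minus_equation_iff neg_0_equal_iff_equal singletonD)
    then show ?thesis
      using step.hyps(2) exhaust_3[of j] unfolding quarter_turns_def S_def[symmetric]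
      by (auto simp: matrix_matrix_mult_def sum_3)
  qed
  ultimately show ?case by blast
qed

lemma signed_unit_row:
  fixes a b c :: real
  assumes "a \<in> {-1, 0, 1}" "b \<in> {-1, 0, 1}" "c \<in> {-1, 0, 1}" "a * a + b * b + c * c = 1"
  shows "(a * a = 1 \<and> b = 0 \<and> c = 0) \<or> (a = 0 \<and> b * b = 1 \<and> c = 0) \<or> (a = 0 \<and> b = 0 \<and> c * c = 1)"
proof -
  have *: "z = 0 \<or> z * z = 1" if "z \<in> {-1, 0, 1}" for z :: real using that by auto
  show ?thesis
    using *[OF assms(1)] *[OF assms(2)] *[OF assms(3)] assms(4) by (elim disjE) simp_all
qed

text \<open>The position of \<open>\<beta>\<close> on the diagonals of the three matrices shows that \<open>R\<close> permutes no axes, so it is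
diagonal with entries \<open>1\<close> and \<open>-1\<close>, and its cube is itself.\<close>

lemma cube_rotation_fixing_triple:
  assumes R: "R \<in> cube_rotations" "R ** R ** R = mat 1" and ab: "\<alpha> \<noteq> \<beta>"
    and fix1: "conj_act R (triple1 \<alpha> \<beta> \<delta> x y \<eta>) = triple1 \<alpha> \<beta> \<delta> x y \<eta>"
    and fix2: "conj_act R (triple2 \<alpha> \<beta> \<delta> x y \<eta>) = triple2 \<alpha> \<beta> \<delta> x y \<eta>"
    and fix3: "conj_act R (triple3 \<alpha> \<beta> \<delta> x y \<eta>) = triple3 \<alpha> \<beta> \<delta> x y \<eta>"
  shows "R = mat 1"
proof -
  note R' = cube_rotation_signed_permutation[OF R(1)]
  have "R ** transpose R = mat 1" using R' by (simp add: orthogonal_matrix_def)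
  then have "(R ** transpose R) $ k $ k = 1" for k by (simp add: mat_def)
  then have norm: "R$k$1 * R$k$1 + R$k$2 * R$k$2 + R$k$3 * R$k$3 = 1" for k
    by (simp add: matrix_matrix_mult_def sum_3 transpose_def)
  have row: "(R$k$1 * R$k$1 = 1 \<and> R$k$2 = 0 \<and> R$k$3 = 0) \<or> (R$k$1 = 0 \<and> R$k$2 * R$k$2 = 1 \<and> R$k$3 = 0)
      \<or> (R$k$1 = 0 \<and> R$k$2 = 0 \<and> R$k$3 * R$k$3 = 1)" for k
    by (rule signed_unit_row[OF _ _ _ norm]) (use R' in blast)+
  have diag: "conj_act R (symmat a b c p q s) $ k $ k
     = a * (R$k$1 * R$k$1) + b * (R$k$2 * R$k$2) + c * (R$k$3 * R$k$3)
       + 2 * (p * (R$k$1 * R$k$2) + q * (R$k$1 * R$k$3) + s * (R$k$2 * R$k$3))" for a b c p q s k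
    by (simp add: conj_act_def matrix_matrix_mult_def sum_3 transpose_def algebra_simps)
  have 3: "R$3$3 * R$3$3 = 1 \<and> R$3$1 = 0 \<and> R$3$2 = 0"
    using row[of 3] arg_cong[OF fix1, of "\<lambda>X. X$3$3"] ab
    unfolding triple1_def diag by auto
  have 2: "R$2$2 * R$2$2 = 1 \<and> R$2$1 = 0 \<and> R$2$3 = 0"
    using row[of 2] arg_cong[OF fix2, of "\<lambda>X. X$2$2"] ab
    unfolding triple2_def diag by auto
  have 1: "R$1$1 * R$1$1 = 1 \<and> R$1$2 = 0 \<and> R$1$3 = 0"
    using row[of 1] arg_cong[OF fix3, of "\<lambda>X. X$1$1"] ab
    unfolding triple3_def diag by auto
  have "(R ** R ** R) $ k $ k = 1" for k using R(2) by (simp add: mat_def)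
  from this[of 1] this[of 2] this[of 3] have "R$1$1 = 1" "R$2$2 = 1" "R$3$3 = 1"
    using 1 2 3 by (simp_all add: matrix_matrix_mult_def sum_3)
  then show ?thesis using 1 2 3 by (simp add: matrix3_eq_iff mat_def)
qed

lemma threefold_permutation:
  assumes r: "\<And>X. r (r (r X)) = X" and V: "r ` {a, b, c} = {a, b, c}" "a \<noteq> b" "b \<noteq> c" "a \<noteq> c"
    and moved: "r a \<noteq> a \<or> r b \<noteq> b \<or> r c \<noteq> c"
  shows "(r a = b \<and> r b = c \<and> r c = a) \<or> (r a = c \<and> r c = b \<and> r b = a)"
proof -
  have "r a \<in> {a, b, c}" "r b \<in> {a, b, c}" "r c \<in> {a, b, c}" using V(1) by blast+
  moreover have "r a \<noteq> r b" "r b \<noteq> r c" "r a \<noteq> r c" using r V(2-4) by metis+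
  moreover have "r (r (r a)) = a" "r (r (r b)) = b" "r (r (r c)) = c" using r by auto
  ultimately show ?thesis using V(2-4) moved by auto
qed

text \<open>A nontrivial permutation of order three of three points is one of the two cycles. So \<open>R\<close> acts on
the triple as the explicit rotation or as its inverse.\<close>

lemma associated_rotation_acts:
  assumes R: "R \<in> associated_rotations {triple1 \<alpha> \<beta> \<delta> x y \<eta>, triple2 \<alpha> \<beta> \<delta> x y \<eta>, triple3 \<alpha> \<beta> \<delta> x y \<eta>}"
    and ab: "\<alpha> \<noteq> \<beta>" and xy: "x = 1 \<or> x = -1" "y = 1 \<or> y = -1"
    and b: "b \<in> {triple1 \<alpha> \<beta> \<delta> x y \<eta>, triple2 \<alpha> \<beta> \<delta> x y \<eta>, triple3 \<alpha> \<beta> \<delta> x y \<eta>}"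
    and det: "det (triple1 \<alpha> \<beta> \<delta> x y \<eta> - triple2 \<alpha> \<beta> \<delta> x y \<eta>) \<noteq> 0"
    and inner_det: "inner_det (conj_act (cycle_matrix x y)) (triple1 \<alpha> \<beta> \<delta> x y \<eta>) (1/2) \<noteq> 0"
  shows "threefold (conj_act R)" "det (b - conj_act R b) \<noteq> 0" "inner_det (conj_act R) b (1/2) \<noteq> 0"
    "barycentre (conj_act R) b
      = (1/3) *\<^sub>R (triple1 \<alpha> \<beta> \<delta> x y \<eta> + triple2 \<alpha> \<beta> \<delta> x y \<eta> + triple3 \<alpha> \<beta> \<delta> x y \<eta>)"
proof -
  let ?g = "conj_act (cycle_matrix x y)" and ?r = "conj_act R"
  let ?a = "triple1 \<alpha> \<beta> \<delta> x y \<eta>" and ?b = "triple2 \<alpha> \<beta> \<delta> x y \<eta>" and ?c = "triple3 \<alpha> \<beta> \<delta> x y \<eta>"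
  have R': "R \<in> cube_rotations" "R \<noteq> mat 1" "R ** R ** R = mat 1" "?r ` {?a, ?b, ?c} = {?a, ?b, ?c}"
    using R unfolding associated_rotations_def by blast+
  have cube: "?r (?r (?r X)) = X" for X
    using R'(3) by (simp add: conj_act_mat_1 matrix_mul_assoc flip: conj_act_mult)
  show r: "threefold ?r"
    unfolding threefold_def
    using strain_symmetry_conj_act cube_rotation_signed_permutation[OF R'(1)] cube by blast
  note g = threefold_cycle[OF xy]
  have orb: "orbit_set ?g ?a = {?a, ?b, ?c}" by (rule orbit_triple[OF xy])
  have gc: "?g ?a = ?b" "?g ?b = ?c" "?g ?c = ?a"
    using cycle_triple[OF xy] threefoldD(2)[OF g] by metis+
  have ne: "?a \<noteq> ?b" using det by (auto simp: det_zero)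
  then have ne': "?b \<noteq> ?c" "?a \<noteq> ?c" using gc threefoldD(2)[OF g] by metis+
  have "?r ?a \<noteq> ?a \<or> ?r ?b \<noteq> ?b \<or> ?r ?c \<noteq> ?c"
    using cube_rotation_fixing_triple[OF R'(1,3) ab] R'(2) by blast
  from threefold_permutation[of ?r, OF cube R'(4) ne ne' this]
  have act: "(?r b = ?g b \<and> ?r (?r b) = ?g (?g b)) \<or> (?r b = ?g (?g b) \<and> ?r (?r b) = ?g b)"
    using b gc by auto
  have bo: "b \<in> orbit_set ?g ?a" using b orb by simp
  have d: "det (?a - ?g ?a) \<noteq> 0" using det gc by simp
  have rb: "?r b \<in> orbit_set ?g ?a" "?r b \<noteq> b"
    using act b gc ne ne' unfolding orb by auto
  show "det (b - ?r b) \<noteq> 0"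
    using det_orbit_differences[OF g bo rb(1) _ d] rb(2) by metis
  have "inner_det ?g b (1/2) \<noteq> 0"
    using bo inner_det inner_det_invariant[OF g] by (auto simp: orbit_set_def)
  moreover have "inner_det (\<lambda>X. ?g (?g X)) b (1/2) = inner_det ?g b (1/2)"
    using inner_det_inverse[OF g, of b "1/2"] by simp
  moreover have "?g (?g (?g (?g b))) = ?g b" using threefoldD(2)[OF g] by simp
  ultimately show "inner_det ?r b (1/2) \<noteq> 0"
    using act unfolding inner_det_def by auto
  have "b + ?g b + ?g (?g b) = ?a + ?b + ?c"
    using b gc by auto
  then show "barycentre ?r b = (1/3) *\<^sub>R (?a + ?b + ?c)"
    using act unfolding barycentre_def by (auto simp: add_ac)
qed

section \<open>The strains and their index sets\<close>

lemma strain_values: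
  "strain \<alpha> \<beta> \<delta> \<epsilon> 1 = symmat \<alpha> \<alpha> \<beta> \<delta> \<epsilon> \<epsilon>"
  "strain \<alpha> \<beta> \<delta> \<epsilon> 2 = symmat \<alpha> \<alpha> \<beta> \<delta> (-\<epsilon>) (-\<epsilon>)"
  "strain \<alpha> \<beta> \<delta> \<epsilon> 3 = symmat \<alpha> \<alpha> \<beta> (-\<delta>) (-\<epsilon>) \<epsilon>"
  "strain \<alpha> \<beta> \<delta> \<epsilon> 4 = symmat \<alpha> \<alpha> \<beta> (-\<delta>) \<epsilon> (-\<epsilon>)"
  "strain \<alpha> \<beta> \<delta> \<epsilon> 5 = symmat \<alpha> \<beta> \<alpha> \<epsilon> \<delta> \<epsilon>"
  "strain \<alpha> \<beta> \<delta> \<epsilon> 6 = symmat \<alpha> \<beta> \<alpha> (-\<epsilon>) \<delta> (-\<epsilon>)"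
  "strain \<alpha> \<beta> \<delta> \<epsilon> 7 = symmat \<alpha> \<beta> \<alpha> (-\<epsilon>) (-\<delta>) \<epsilon>"
  "strain \<alpha> \<beta> \<delta> \<epsilon> 8 = symmat \<alpha> \<beta> \<alpha> \<epsilon> (-\<delta>) (-\<epsilon>)"
  "strain \<alpha> \<beta> \<delta> \<epsilon> 9 = symmat \<beta> \<alpha> \<alpha> \<epsilon> \<epsilon> \<delta>"
  "strain \<alpha> \<beta> \<delta> \<epsilon> 10 = symmat \<beta> \<alpha> \<alpha> (-\<epsilon>) (-\<epsilon>) \<delta>"
  "strain \<alpha> \<beta> \<delta> \<epsilon> 11 = symmat \<beta> \<alpha> \<alpha> (-\<epsilon>) \<epsilon> (-\<delta>)"
  "strain \<alpha> \<beta> \<delta> \<epsilon> 12 = symmat \<beta> \<alpha> \<alpha> \<epsilon> (-\<epsilon>) (-\<delta>)"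
  by (simp_all add: strain_def)

lemma r0_values:
  "r0 1 = 2" "r0 2 = 1" "r0 3 = 4" "r0 4 = 3" "r0 5 = 6" "r0 6 = 5" "r0 7 = 8" "r0 8 = 7"
  "r0 9 = 10" "r0 10 = 9" "r0 11 = 12" "r0 12 = 11"
  by (simp_all add: r0_def)

text \<open>The signs of the axis \<open>(x, y, 1)\<close> of a \<open>T\<^sub>3\<close>, read off from its strains with \<open>\<beta>\<close> in the second and in the first
diagonal position.\<close>

definition sign_x :: "nat set \<Rightarrow> real" where "sign_x \<tau> = (if 5 \<in> \<tau> \<or> 6 \<in> \<tau> then -1 else 1)"
definition sign_y :: "nat set \<Rightarrow> real" where "sign_y \<tau> = (if 9 \<in> \<tau> \<or> 10 \<in> \<tau> then -1 else 1)"

lemma signs: "sign_x \<tau> = 1 \<or> sign_x \<tau> = -1" "sign_y \<tau> = 1 \<or> sign_y \<tau> = -1"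
  by (auto simp: sign_x_def sign_y_def)

lemma sign_values:
  "sign_x {1,6,12} = -1" "sign_x {1,8,10} = 1" "sign_x {2,5,11} = -1" "sign_x {2,7,9} = 1"
  "sign_x {3,6,9} = -1" "sign_x {3,8,11} = 1" "sign_x {4,5,10} = -1" "sign_x {4,7,12} = 1"
  "sign_y {1,6,12} = 1" "sign_y {1,8,10} = -1" "sign_y {2,5,11} = 1" "sign_y {2,7,9} = -1"
  "sign_y {3,6,9} = -1" "sign_y {3,8,11} = 1" "sign_y {4,5,10} = -1" "sign_y {4,7,12} = 1"
  by (simp_all add: sign_x_def sign_y_def)

lemma strain_image_T3_index_sets:
  assumes "\<tau> \<in> T3_index_sets"
  obtains \<eta> where "\<eta> = \<epsilon> \<or> \<eta> = - \<epsilon>"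
    "strain \<alpha> \<beta> \<delta> \<epsilon> ` \<tau> = {triple1 \<alpha> \<beta> \<delta> (sign_x \<tau>) (sign_y \<tau>) \<eta>,
      triple2 \<alpha> \<beta> \<delta> (sign_x \<tau>) (sign_y \<tau>) \<eta>, triple3 \<alpha> \<beta> \<delta> (sign_x \<tau>) (sign_y \<tau>) \<eta>}"
    "strain \<alpha> \<beta> \<delta> \<epsilon> ` r0 ` \<tau> = {triple1 \<alpha> \<beta> \<delta> (sign_x \<tau>) (sign_y \<tau>) (-\<eta>),
      triple2 \<alpha> \<beta> \<delta> (sign_x \<tau>) (sign_y \<tau>) (-\<eta>), triple3 \<alpha> \<beta> \<delta> (sign_x \<tau>) (sign_y \<tau>) (-\<eta>)}"
proof -
  note d = triple1_def triple2_def triple3_def strain_values r0_values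
  let ?P = "\<lambda>\<eta>. strain \<alpha> \<beta> \<delta> \<epsilon> ` \<tau> = {triple1 \<alpha> \<beta> \<delta> (sign_x \<tau>) (sign_y \<tau>) \<eta>,
      triple2 \<alpha> \<beta> \<delta> (sign_x \<tau>) (sign_y \<tau>) \<eta>, triple3 \<alpha> \<beta> \<delta> (sign_x \<tau>) (sign_y \<tau>) \<eta>} \<and>
    strain \<alpha> \<beta> \<delta> \<epsilon> ` r0 ` \<tau> = {triple1 \<alpha> \<beta> \<delta> (sign_x \<tau>) (sign_y \<tau>) (-\<eta>),
      triple2 \<alpha> \<beta> \<delta> (sign_x \<tau>) (sign_y \<tau>) (-\<eta>), triple3 \<alpha> \<beta> \<delta> (sign_x \<tau>) (sign_y \<tau>) (-\<eta>)}"
  have "?P \<epsilon> \<or> ?P (- \<epsilon>)"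
    using assms unfolding T3_index_sets_def
    by (elim insertE emptyE; simp only: sign_values image_insert image_empty d; simp)
  then show thesis using that by blast
qed

text \<open>Neighbours have different axes \<open>v\<close> and \<open>v'\<close>. Two different diagonals of the cube
satisfy \<open>v \<bullet> v' = \<plusminus> 1\<close>, and the sum is \<open>((v \<bullet> v')\<^sup>2 - 3) / 2\<close>.\<close>

lemma neighbours_signs:
  assumes "\<tau> \<in> T3_index_sets" "\<tau>' \<in> neighbours \<tau>"
  shows "sign_x \<tau>' * sign_y \<tau>' * sign_x \<tau> * sign_y \<tau> + sign_x \<tau>' * sign_x \<tau> + sign_y \<tau>' * sign_y \<tau> = -1"
proof -
  have "\<tau>' \<in> T3_index_sets" "\<tau>' \<noteq> \<tau>" "\<tau>' \<inter> \<tau> \<noteq> {}"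
    using assms(2) by (auto simp: neighbours_def)
  with assms(1) show ?thesis
    unfolding T3_index_sets_def by (elim insertE emptyE) (simp_all add: sign_x_def sign_y_def)
qed

lemma index_cases:
  assumes "k \<in> {1..12::nat}"
  shows "k \<in> {1,2,3,4,5,6,7,8,9,10,11,12}"
proof -
  have "k = 1 \<or> k = 2 \<or> k = 3 \<or> k = 4 \<or> k = 5 \<or> k = 6 \<or> k = 7 \<or> k = 8 \<or> k = 9 \<or> k = 10 \<or> k = 11 \<or> k = 12"
    using assms unfolding atLeastAtMost_iff by presburger
  then show ?thesis by simp
qed

lemma strains_trace_space: "strains \<alpha> \<beta> \<delta> \<epsilon> \<subseteq> trace_space (2 * \<alpha> + \<beta>)"
proof -
  have "strain \<alpha> \<beta> \<delta> \<epsilon> k \<in> trace_space (2 * \<alpha> + \<beta>)" if "k \<in> {1..12}" for k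
    using index_cases[OF that]
    by (elim insertE emptyE) (simp_all only: strain_values, simp_all add: trace_space_def symmetric_symmat trace_symmat)
  then show ?thesis unfolding strains_def by blast
qed

lemma axis_value_strains:
  assumes "0 < \<delta>" "0 < \<epsilon>" "\<epsilon> \<le> \<delta>" "x = 1 \<or> x = -1" "y = 1 \<or> y = -1" "X \<in> strains \<alpha> \<beta> \<delta> \<epsilon>"
  shows "- \<delta> \<le> axis_value x y X"
proof -
  obtain k where k: "k \<in> {1..12}" "X = strain \<alpha> \<beta> \<delta> \<epsilon> k" using assms(6) by (auto simp: strains_def)
  show ?thesis
    using index_cases[OF k(1)] assms(4,5) unfolding k(2) using assms(1-3)
    by (elim insertE emptyE disjE) (simp_all only: strain_values, simp_all add: axis_value_def)
qed

lemma axis_value_barycentre: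
  assumes "x * y * x' * y' + x * x' + y * y' = -1"
  shows "axis_value x y ((1/3) *\<^sub>R (triple1 \<alpha> \<beta> \<delta> x' y' \<eta> + triple2 \<alpha> \<beta> \<delta> x' y' \<eta> + triple3 \<alpha> \<beta> \<delta> x' y' \<eta>))
    = \<delta> / 3"
proof -
  have "axis_value x y ((1/3) *\<^sub>R (triple1 \<alpha> \<beta> \<delta> x' y' \<eta> + triple2 \<alpha> \<beta> \<delta> x' y' \<eta> + triple3 \<alpha> \<beta> \<delta> x' y' \<eta>))
    = - (\<delta> / 3) * (x * y * x' * y' + x * x' + y * y')"
    unfolding triple1_def triple2_def triple3_def symmat_linear axis_value_def symmat_nth
    by (simp add: field_simps)
  then show ?thesis by (simp add: assms)
qed

text \<open>Eight times the value of \<open>inner_det\<close> at \<open>1/2\<close> for each of the eight triples.\<close>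

definition genericity :: "real \<times> real \<times> real \<times> real \<Rightarrow> real" where
  "genericity = (\<lambda>v. let \<alpha> = fst v; \<beta> = fst (snd v); \<delta> = fst (snd (snd v)); \<epsilon> = snd (snd (snd v)) in
     2 * (\<alpha> - \<beta>)^3 - 6 * (\<alpha> - \<beta>) * \<delta>^2 + 18 * (\<alpha> - \<beta>) * \<epsilon>^2 + 4 * \<delta>^3 - 36 * \<delta> * \<epsilon>^2)"

lemma real_polynomial_function_genericity: "real_polynomial_function genericity"
proof -
  have "real_polynomial_function (\<lambda>v :: real \<times> real \<times> real \<times> real. fst v)"
    "real_polynomial_function (\<lambda>v :: real \<times> real \<times> real \<times> real. fst (snd v))"
    "real_polynomial_function (\<lambda>v :: real \<times> real \<times> real \<times> real. fst (snd (snd v)))"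
    "real_polynomial_function (\<lambda>v :: real \<times> real \<times> real \<times> real. snd (snd (snd v)))"
    by (rule real_polynomial_function_linear, rule linearI; simp)+
  then show ?thesis
    unfolding genericity_def Let_def
    by (intro real_polynomial_function.intros(2-4) real_polynomial_function_diff real_polynomial_function_power)
qed

lemma neighbouring_triples:
  fixes \<alpha> \<beta> \<delta> \<epsilon> :: real and t t' :: "3 \<Rightarrow> nat"
  assumes pos: "\<delta> > 0" "\<epsilon> > 0" and ab: "\<alpha> \<noteq> \<beta>" and nondeg: "(\<alpha> - \<beta>) * \<delta> + \<epsilon>^2 - \<delta>^2 \<noteq> 0"
    and gen: "genericity (\<alpha>, \<beta>, \<delta>, \<epsilon>) \<noteq> 0"
    and \<tau>: "\<tau> \<in> T3_index_sets" "\<tau>1 \<in> neighbours \<tau>"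
    and R: "R \<in> associated_rotations (strain \<alpha> \<beta> \<delta> \<epsilon> ` \<tau>)"
    and t: "range t = \<tau>1" "range t' = r0 ` \<tau>1"
  shows "let n = T3_node (strain \<alpha> \<beta> \<delta> \<epsilon> \<circ> t);
           n' = T3_node (strain \<alpha> \<beta> \<delta> \<epsilon> \<circ> t');
           C = convex hull (range n \<union> range n')
       in aff_dim C = 4 \<and>
          (\<forall>w \<in> weights.
             mixture n n' w \<in> C \<and>
             mixture n n' w \<in> lamination_hull (range n \<union> range n') \<and>
             (\<not> compatible (mixture n n' w) (conj_act R (mixture n n' w)) \<longrightarrow>
                is_symmetric_T3 (orbit3 R (mixture n n' w)))) \<and>
          generically_on C (\<lambda>p. is_symmetric_T3 (orbit3 R p)) \<and>
          five_dimensional (2 * \<alpha> + \<beta>) (T3_union R n n') \<and>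
          (\<epsilon> \<le> \<delta> \<longrightarrow>
             T3_union R n n' \<inter>
               (top_of_set (trace_space (2 * \<alpha> + \<beta>))) frontier_of
                 (rank_one_hull (strains \<alpha> \<beta> \<delta> \<epsilon>)) \<noteq> {})"
proof -
  have \<tau>1: "\<tau>1 \<in> T3_index_sets" "\<tau>1 \<inter> \<tau> \<noteq> {}" using \<tau>(2) by (auto simp: neighbours_def)
  define x y where xy_def: "x = sign_x \<tau>1" "y = sign_y \<tau>1"
  define x' y' where xy'_def: "x' = sign_x \<tau>" "y' = sign_y \<tau>"
  have xy: "x = 1 \<or> x = -1" "y = 1 \<or> y = -1" unfolding xy_def by (rule signs)+
  have xy': "x' = 1 \<or> x' = -1" "y' = 1 \<or> y' = -1" unfolding xy'_def by (rule signs)+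
  let ?V = "\<lambda>x y \<eta>. {triple1 \<alpha> \<beta> \<delta> x y \<eta>, triple2 \<alpha> \<beta> \<delta> x y \<eta>, triple3 \<alpha> \<beta> \<delta> x y \<eta>}"
  obtain \<eta> where \<eta>: "\<eta> = \<epsilon> \<or> \<eta> = - \<epsilon>" "strain \<alpha> \<beta> \<delta> \<epsilon> ` \<tau>1 = ?V x y \<eta>"
    "strain \<alpha> \<beta> \<delta> \<epsilon> ` r0 ` \<tau>1 = ?V x y (- \<eta>)"
    using strain_image_T3_index_sets[OF \<tau>1(1), of \<epsilon> \<alpha> \<beta> \<delta>, folded xy_def] .
  obtain \<eta>' where \<eta>': "\<eta>' = \<epsilon> \<or> \<eta>' = - \<epsilon>" "strain \<alpha> \<beta> \<delta> \<epsilon> ` \<tau> = ?V x' y' \<eta>'"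
    by (rule strain_image_T3_index_sets[OF \<tau>(1), of \<epsilon> \<alpha> \<beta> \<delta>, folded xy'_def])
  have det: "det (triple1 \<alpha> \<beta> \<delta> u v \<zeta> - conj_act (cycle_matrix u v) (triple1 \<alpha> \<beta> \<delta> u v \<zeta>)) \<noteq> 0"
    if "u = 1 \<or> u = -1" "v = 1 \<or> v = -1" "\<zeta> = \<epsilon> \<or> \<zeta> = - \<epsilon>" for u v \<zeta>
    unfolding det_triple[OF that(1,2)] using that(3) pos nondeg by auto
  have inner_det: "inner_det (conj_act (cycle_matrix u v)) (triple1 \<alpha> \<beta> \<delta> u v \<zeta>) (1/2) \<noteq> 0"
    if "u = 1 \<or> u = -1" "v = 1 \<or> v = -1" "\<zeta> = \<epsilon> \<or> \<zeta> = - \<epsilon>" for u v \<zeta>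
    using inner_det_triple[OF that(1,2), of \<alpha> \<beta> \<delta> \<zeta>] that(3) gen by (auto simp: genericity_def)
  let ?g = "conj_act (cycle_matrix x y)" and ?q = "conj_act (swap_matrix x y)"
  let ?a = "triple1 \<alpha> \<beta> \<delta> x y \<eta>"
  have orb: "orbit_set ?g ?a = ?V x y \<eta>" "orbit_set ?g (?q ?a) = ?V x y (- \<eta>)"
    unfolding swap_triple[OF xy] by (rule orbit_triple[OF xy])+
  let ?A = "{X. symmetric X \<and> trace X = 2 * \<alpha> + \<beta> \<and> axis_value x y X = - \<delta>}"
  have VA: "?V x y \<zeta> \<subseteq> ?A" for \<zeta>
    using symmetric_triple trace_triple axis_value_triple[OF xy] by auto
  have affA: "affine ?A"
  proof -
    have level: "affine {X. f X = k}" if "linear f" for f :: "real^3^3 \<Rightarrow> real" and k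
      using that by (auto simp: affine_def linear_add linear_cmul simp flip: distrib_right)
    have "affine {X :: real^3^3. symmetric X}"
      by (simp add: affine_def vec_eq_iff transpose_def)
    then have "affine ({X. symmetric X} \<inter> {X. trace X = 2 * \<alpha> + \<beta>} \<inter> {X. axis_value x y X = - \<delta>})"
      by (intro affine_Int level linear_trace linear_axis_value)
    moreover have "{X. symmetric X} \<inter> {X. trace X = 2 * \<alpha> + \<beta>} \<inter> {X. axis_value x y X = - \<delta>} = ?A"
      by blast
    ultimately show ?thesis by simp
  qed
  have hull: "affine hull (orbit_set ?g ?a \<union> orbit_set ?g (?q ?a)) = ?A"
  proof
    show "affine hull (orbit_set ?g ?a \<union> orbit_set ?g (?q ?a)) \<subseteq> ?A"
      unfolding orb using VA affA by (intro hull_minimal) auto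
    show "?A \<subseteq> affine hull (orbit_set ?g ?a \<union> orbit_set ?g (?q ?a))"
    proof
      fix X assume X: "X \<in> ?A"
      show "X \<in> affine hull (orbit_set ?g ?a \<union> orbit_set ?g (?q ?a))"
      proof (rule axis_space_subset[OF xy ab])
        show "\<eta> \<noteq> 0" using \<eta>(1) pos by auto
        show "?V x y \<eta> \<union> ?V x y (- \<eta>) \<subseteq> affine hull (orbit_set ?g ?a \<union> orbit_set ?g (?q ?a))"
          unfolding orb by (rule hull_subset)
      qed (use X affine_affine_hull in auto)
    qed
  qed
  obtain k where k: "k \<in> \<tau>1" "k \<in> \<tau>" using \<tau>1(2) by blast
  define b where "b = strain \<alpha> \<beta> \<delta> \<epsilon> k"
  have bV: "b \<in> ?V x y \<eta>" "b \<in> ?V x' y' \<eta>'"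
    unfolding \<eta>(2)[symmetric] \<eta>'(2)[symmetric] b_def using k by blast+
  have det': "det (triple1 \<alpha> \<beta> \<delta> x' y' \<eta>' - triple2 \<alpha> \<beta> \<delta> x' y' \<eta>') \<noteq> 0"
    using det[OF xy' \<eta>'(1)] cycle_triple(1)[OF xy'] by simp
  note rot = associated_rotation_acts[OF R[unfolded \<eta>'(2)] ab xy' bV(2) det' inner_det[OF xy' \<eta>'(1)]]
  have bary: "axis_value x y (barycentre (conj_act R) b) \<noteq> - \<delta>"
  proof -
    have "x * y * x' * y' + x * x' + y * y' = -1"
      using neighbours_signs[OF \<tau>] unfolding xy_def xy'_def .
    from axis_value_barycentre[OF this] show ?thesis unfolding rot(4) using pos(1) by (simp only:)
  qed
  have sub: "\<sigma> \<subseteq> {1..12}" "r0 ` \<sigma> \<subseteq> {1..12}" if "\<sigma> \<in> T3_index_sets" for \<sigma>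
    using that unfolding T3_index_sets_def
    by (elim insertE emptyE; simp only: image_insert image_empty r0_values; simp)+
  have E: "finite (strains \<alpha> \<beta> \<delta> \<epsilon>)" "orbit_set ?g ?a \<subseteq> strains \<alpha> \<beta> \<delta> \<epsilon>"
    "orbit_set ?g (?q ?a) \<subseteq> strains \<alpha> \<beta> \<delta> \<epsilon>"
    unfolding orb \<eta>(2)[symmetric] \<eta>(3)[symmetric] strains_def using sub[OF \<tau>1(1)] by (auto intro: image_mono)
  have e: "range (strain \<alpha> \<beta> \<delta> \<epsilon> \<circ> t) = orbit_set ?g ?a"
    "range (strain \<alpha> \<beta> \<delta> \<epsilon> \<circ> t') = orbit_set ?g (?q ?a)"
    unfolding orb \<eta>(2)[symmetric] \<eta>(3)[symmetric] image_comp[symmetric] t by simp_all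
  show ?thesis
  proof (rule triple_and_dual[OF threefold_cycle[OF xy] swap_involution[OF xy] e symmetric_triple(1)
        det[OF xy \<eta>(1)] inner_det[OF xy \<eta>(1)] linear_axis_value refl aff_dim_axis_space[OF xy] hull rot(1)
        _ rot(2,3) bary E strains_trace_space])
    show "b \<in> ?A" using bV(1) VA by blast
    show "\<forall>X\<in>strains \<alpha> \<beta> \<delta> \<epsilon>. - \<delta> \<le> axis_value x y X" if "\<epsilon> \<le> \<delta>"
      using axis_value_strains[OF pos that xy] by blast
  qed
qed

theorem mainTheorem6:
  shows "\<exists>P :: real \<times> real \<times> real \<times> real \<Rightarrow> real.
    real_polynomial_function P \<and> (\<exists>\<alpha> \<beta> \<delta>. P (\<alpha>, \<beta>, \<delta>, \<delta>) \<noteq> 0) \<and>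
    (\<forall>\<alpha> \<beta> \<delta> \<epsilon> :: real. \<forall>\<tau> \<tau>1 \<tau>2 \<tau>3 :: nat set. \<forall>R :: real^3^3. \<forall>t t' :: 3 \<Rightarrow> nat.
      \<delta> > 0 \<longrightarrow> \<epsilon> > 0 \<longrightarrow> \<alpha> \<noteq> \<beta> \<longrightarrow> (\<alpha> - \<beta>) * \<delta> + \<epsilon>^2 - \<delta>^2 \<noteq> 0 \<longrightarrow>
      P (\<alpha>, \<beta>, \<delta>, \<epsilon>) \<noteq> 0 \<longrightarrow>
      \<tau> \<in> T3_index_sets \<longrightarrow> {\<tau>1, \<tau>2, \<tau>3} = neighbours \<tau> \<longrightarrow>
      R \<in> associated_rotations (strain \<alpha> \<beta> \<delta> \<epsilon> ` \<tau>) \<longrightarrow>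
      range t = \<tau>1 \<longrightarrow> range t' = r0 ` \<tau>1 \<longrightarrow>
      (let n = T3_node (strain \<alpha> \<beta> \<delta> \<epsilon> \<circ> t);
           n' = T3_node (strain \<alpha> \<beta> \<delta> \<epsilon> \<circ> t');
           C = convex hull (range n \<union> range n')
       in aff_dim C = 4 \<and>
          (\<forall>w \<in> weights.
             mixture n n' w \<in> C \<and>
             mixture n n' w \<in> lamination_hull (range n \<union> range n') \<and>
             (\<not> compatible (mixture n n' w) (conj_act R (mixture n n' w)) \<longrightarrow>
                is_symmetric_T3 (orbit3 R (mixture n n' w)))) \<and>
          generically_on C (\<lambda>p. is_symmetric_T3 (orbit3 R p)) \<and>
          five_dimensional (2 * \<alpha> + \<beta>) (T3_union R n n') \<and>
          (\<epsilon> \<le> \<delta> \<longrightarrow>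
             T3_union R n n' \<inter>
               (top_of_set (trace_space (2 * \<alpha> + \<beta>))) frontier_of
                 (rank_one_hull (strains \<alpha> \<beta> \<delta> \<epsilon>)) \<noteq> {})))"
proof (intro exI[of _ genericity] conjI allI impI)
  show "real_polynomial_function genericity" by (rule real_polynomial_function_genericity)
  show "\<exists>\<alpha> \<beta> \<delta>. genericity (\<alpha>, \<beta>, \<delta>, \<delta>) \<noteq> 0"
    by (intro exI[of _ 0] exI[of _ 1]) (simp add: genericity_def)
qed (rule neighbouring_triples; blast)

end
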